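(* Let $\mu,\nu$ be probability measures on $\mathcal{X}$ with $\mu\ll\nu$. Assume there is a finite $n_0$ with $E^\mu[D(\pi_{n_0}^\mu\|\pi_{n_0}^\nu)]<\infty$ and some $m$ with $D(P^\mu|_{\mathcal{F}^{\mathcal{Y}}_{0,m}}\|P^\nu|_{\mathcal{F}^{\mathcal{Y}}_{0,m}})<\infty$. Then $\lim_{n\to\infty}E^\mu[D(\pi_n^\mu\|\pi_n^\nu)]=0$ if and only if $\lim_{n\to\infty}E^\mu[\|\pi_n^\mu-\pi_n^\nu\|_{TV}]=0$.
   Context: Setting: $\mathcal{X},\mathcal{Y},\mathcal{Z}$ are Polish spaces. $T$ is a transition kernel on $\mathcal{X}$; $\{Z_n\}$ is i.i.d. with law $Q$, independent of the states; $h:\mathcal{X}\times\mathcal{Z}\to\mathcal{Y}$ measurable. $\{X_n\}$ is a Markov chain with kernel $T$, $X_0\sim\mu$, $Y_n=h(X_n,Z_n)$; $P^\mu$, $E^\mu$ are the joint law on $(\mathcal{X}\times\mathcal{Y})^{\mathbb{Z}_+}$ and expectation. Filter $\pi_n^{\mu}=P^{\mu}(X_n\in\cdot\mid Y_0,\dots,Y_n)$. $\mathcal{F}^{\mathcal{Y}}_{0,m}$ is the $\sigma$-field generated by $Y_0,\dots,Y_m$, and $P|_{\mathcal{G}}$ denotes restriction to $\mathcal{G}$. Relative entropy $D(P\|R)=\int\log\frac{dP}{dR}\,dP$ for $P\ll R$. Total variation: $\|P-R\|_{TV}=\sup_{\|f\|_\infty\le1}|\int f\,dP-\int f\,dR|$.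 *)

theory Defs
  imports "HOL-Probability.Probability"
begin

text \<open>Relative entropy D(P||R) = integral of log (dP/dR) with respect to P, for P abs. cont.
  w.r.t. R (extended-real valued: positive part minus negative part of the integral);
  by convention +infinity when P is not absolutely continuous w.r.t. R.\<close>
definition rel_entropy :: "'a measure \<Rightarrow> 'a measure \<Rightarrow> ereal" where
  "rel_entropy P R =
    (if sets P = sets R \<and> absolutely_continuous R P then
       enn2ereal (\<integral>\<^sup>+ x. ennreal (ln (enn2real (RN_deriv R P x))) \<partial>P)
     - enn2ereal (\<integral>\<^sup>+ x. ennreal (- ln (enn2real (RN_deriv R P x))) \<partial>P)
     else \<infinity>)"

definition tv_dist :: "'a measure \<Rightarrow> 'a measure \<Rightarrow> real" where
  "tv_dist P R =
    (SUP f \<in> {f. f \<in> borel_measurable P \<and> (\<forall>x. \<bar>f x\<bar> \<le> 1)}.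
        \<bar>(\<integral>x. f x \<partial>P) - (\<integral>x. f x \<partial>R)\<bar>)"

definition path_space :: "(nat \<Rightarrow> ('x::topological_space \<times> 'y::topological_space)) measure" where
  "path_space = (\<Pi>\<^sub>M i\<in>(UNIV::nat set). (borel :: ('x \<times> 'y) measure))"

definition obs_kernel :: "('x \<Rightarrow> 'z \<Rightarrow> 'y) \<Rightarrow> 'z measure \<Rightarrow> 'x \<Rightarrow> ('x::topological_space \<times> 'y::topological_space) measure" where
  "obs_kernel h Q x = distr Q borel (\<lambda>z. (x, h x z))"

primrec hmm_fdd :: "('x \<Rightarrow> 'x measure) \<Rightarrow> 'z measure \<Rightarrow> ('x \<Rightarrow> 'z \<Rightarrow> 'y) \<Rightarrow> 'x measure \<Rightarrow> nat
     \<Rightarrow> (nat \<Rightarrow> ('x::topological_space \<times> 'y::topological_space)) measure" where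
  "hmm_fdd T Q h \<mu> 0 =
     distr (bind \<mu> (obs_kernel h Q)) (\<Pi>\<^sub>M i\<in>{..0::nat}. borel) (\<lambda>s. \<lambda>i\<in>{..0::nat}. s)"
| "hmm_fdd T Q h \<mu> (Suc n) =
     bind (hmm_fdd T Q h \<mu> n)
       (\<lambda>\<omega>. distr (bind (T (fst (\<omega> n))) (obs_kernel h Q)) (\<Pi>\<^sub>M i\<in>{..Suc n}. borel)
               (\<lambda>s. fun_upd \<omega> (Suc n) s))"

definition hmm_law :: "('x \<Rightarrow> 'x measure) \<Rightarrow> 'z measure \<Rightarrow> ('x \<Rightarrow> 'z \<Rightarrow> 'y) \<Rightarrow> 'x measure
     \<Rightarrow> (nat \<Rightarrow> ('x::topological_space \<times> 'y::topological_space)) measure \<Rightarrow> bool" where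
  "hmm_law T Q h \<mu> P \<longleftrightarrow>
     prob_space P \<and> sets P = sets path_space \<and>
     (\<forall>n. distr P (\<Pi>\<^sub>M i\<in>{..n}. borel) (\<lambda>\<omega>. restrict \<omega> {..n}) = hmm_fdd T Q h \<mu> n)"

definition obs_sigma :: "nat \<Rightarrow> (nat \<Rightarrow> ('x::topological_space \<times> 'y::topological_space)) measure" where
  "obs_sigma m = vimage_algebra (space path_space) (\<lambda>\<omega>. \<lambda>i\<in>{..m}. snd (\<omega> i))
                    (\<Pi>\<^sub>M i\<in>{..m}. (borel :: 'y measure))"

text \<open>\<pi> is a (regular) version of the filter P(X_n \<in> . | Y_0, ..., Y_n) under P.\<close>
definition hmm_filter :: "(nat \<Rightarrow> ('x::topological_space \<times> 'y::topological_space)) measure \<Rightarrow> nat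
     \<Rightarrow> ((nat \<Rightarrow> 'x \<times> 'y) \<Rightarrow> 'x measure) \<Rightarrow> bool" where
  "hmm_filter P n \<pi> \<longleftrightarrow>
     (\<forall>\<omega>\<in>space P. prob_space (\<pi> \<omega>) \<and> sets (\<pi> \<omega>) = sets (borel :: 'x measure)) \<and>
     (\<forall>A \<in> sets (borel :: 'x measure).
        (\<lambda>\<omega>. measure (\<pi> \<omega>) A) \<in> borel_measurable (obs_sigma n) \<and>
        (\<forall>F \<in> sets (obs_sigma n).
           (\<integral>\<omega>. indicator F \<omega> * measure (\<pi> \<omega>) A \<partial>P)
             = measure P (F \<inter> {\<omega> \<in> space P. fst (\<omega> n) \<in> A})))"

end

theory Submission
  imports Defs
begin

text \<open>
  Write \<open>z n\<close> and \<open>v n\<close> for the likelihood ratios \<open>dP\<mu>/dP\<nu>\<close> on \<open>\<sigma>(X n, Y 0, ..., Y n)\<close> and on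
  \<open>\<sigma>(Y 0, ..., Y n)\<close>. By Bayes' formula the filter of \<open>P\<mu>\<close> has density \<open>z n / v n\<close> with respect to the
  filter of \<open>P\<nu>\<close>, so the expected relative entropy is the \<open>P\<nu>\<close>-integral of \<open>z ln (z / v) - z + v\<close>
  and the expected total variation is the \<open>P\<nu>\<close>-integral of \<open>\<bar>z - v\<bar>\<close>. Entropy controls total variation by
  a pointwise inequality of Pinsker type. Conversely, let \<open>k\<close> be a time with finite expected entropy. With \<open>m = v k\<close>,
  for \<open>0 < d \<le> 1 \<le> K\<close>, pointwise
  \<open>z ln (z / v) - z + v \<le> (z ln (z / (K m)))\<^sup>+ + z (ln (d m / v))\<^sup>+ + (ln K - ln d + 2) \<bar>z - v\<bar>\<close>.
  The second term integrates to at most \<open>d\<close>. By the Markov property \<open>z n\<close> is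
  the conditional expectation of \<open>z k\<close> for \<open>n \<ge> k\<close>, so by Jensen the integral of the first term at time \<open>n\<close> is bounded
  by its value at time \<open>k\<close>, which vanishes as \<open>K\<close> grows. No martingale convergence is needed.
\<close>

section \<open>Pointwise entropy inequalities\<close>

text \<open>The perspective \<open>v * \<theta>(z / v)\<close> of the nonnegative integrand \<open>\<theta>(r) = r ln r - r + 1\<close> of relative entropy.\<close>
definition ent_gap :: "real \<Rightarrow> real \<Rightarrow> real" where
  "ent_gap z v = z * ln (z / v) - z + v"

text \<open>This is \<open>ln x \<le> x - 1\<close> at \<open>x = v / z\<close>. The third
  assumption excludes \<open>v = 0 < z\<close>, where the entropy should be infinite but the
  convention for division by zero would give the value \<open>- z\<close>.\<close>

lemma ent_gap_nonneg: assumes "0 \<le> z" "0 \<le> v" "v = 0 \<Longrightarrow> z = 0" shows "0 \<le> ent_gap z v"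
proof (cases "z = 0")
  case False
  then have p: "z > 0" "v > 0" using assms by (auto simp: less_le)
  have "ln (v / z) \<le> v / z - 1" using p by (intro ln_le_minus_one) auto
  then have "z * ln (v / z) \<le> v - z" using p by (simp add: field_simps)
  moreover have "ln (v / z) = - ln (z / v)" using p by (simp add: ln_div)
  ultimately show ?thesis by (simp add: ent_gap_def)
qed (use assms in \<open>simp add: ent_gap_def\<close>)

text \<open>A Hellinger argument. With \<open>a\<close> and \<open>b\<close> the square roots of
  \<open>z\<close> and \<open>v\<close>, the gap dominates the square of
  \<open>s = \<bar>a - b\<bar>\<close>, while \<open>\<bar>z - v\<bar> = s * (a + b)\<close> and
  \<open>a + b \<le> s + 2 * b\<close>. Young's inequality with weight \<open>e\<close> splits the
  mixed term. Keeping \<open>e\<close> free makes the bound linear in the gap, so it can be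
  integrated directly.\<close>

lemma abs_diff_le_ent_gap:
  assumes "0 \<le> z" "0 \<le> v" "v = 0 \<Longrightarrow> z = 0" "0 < e"
  shows "\<bar>z - v\<bar> \<le> e * v + (1 + 1 / e) * ent_gap z v"
proof (cases "z = 0")
  case True
  have "v \<le> e * v + (1 + 1/e) * v" using assms by (simp add: field_simps)
  then show ?thesis using True assms by (simp add: ent_gap_def)
next
  case False
  then have p: "z > 0" "v > 0" using assms by (auto simp: less_le)
  define a b where "a = sqrt z" and "b = sqrt v"
  have ab: "a > 0" "b > 0" "z = a\<^sup>2" "v = b\<^sup>2" using p by (auto simp: a_def b_def)
  have "ln (b / a) \<le> b / a - 1" using ab by (intro ln_le_minus_one) auto
  then have "a * ln (b / a) \<le> b - a" using ab by (simp add: field_simps)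
  then have "a * (a * ln (b / a)) \<le> a * (b - a)" using ab by (intro mult_left_mono) auto
  moreover have "ln (z / v) = - 2 * ln (b / a)" using ab by (simp add: ln_div ln_realpow)
  ultimately have 1: "(a - b)\<^sup>2 \<le> ent_gap z v" 
    by (simp add: ent_gap_def ab power2_eq_square algebra_simps)
  define s where "s = \<bar>a - b\<bar>"
  have "z - v = (a - b) * (a + b)" using ab by (simp add: power2_eq_square algebra_simps)
  then have "\<bar>z - v\<bar> = s * (a + b)" using ab by (simp add: s_def abs_mult)
  also have "\<dots> \<le> s * (s + 2 * b)" using ab by (intro mult_left_mono) (auto simp: s_def)
  also have "\<dots> = s\<^sup>2 + 2 * (s * b)" by (simp add: power2_eq_square algebra_simps)
  also have "2 * (s * b) \<le> e * b\<^sup>2 + s\<^sup>2 / e"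
  proof -
    have "0 \<le> (e * b - s)\<^sup>2 / e" using assms by simp
    also have "\<dots> = e * b\<^sup>2 - 2 * (s * b) + s\<^sup>2 / e" using assms by (simp add: power2_eq_square field_simps)
    finally show ?thesis by simp
  qed
  finally have "\<bar>z - v\<bar> \<le> e * v + (1 + 1/e) * s\<^sup>2" using ab by (simp add: algebra_simps)
  also have "\<dots> \<le> e * v + (1 + 1/e) * ent_gap z v" using 1 assms by (intro add_left_mono mult_left_mono) (auto simp: s_def)
  finally show ?thesis .
qed

text \<open>Clip \<open>ln (x / m)\<close> to the interval from \<open>ln d\<close> to
  \<open>ln K\<close>. The excess of \<open>ln (z / m)\<close> above \<open>ln K\<close> and the
  deficit of \<open>ln (v / m)\<close> below \<open>ln d\<close> produce the first two terms. The
  clipped difference \<open>c z - c v\<close> is bounded, and for \<open>v \<le> z\<close> it is at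
  most \<open>ln (z / v)\<close>, so it only costs a multiple of
  \<open>\<bar>z - v\<bar>\<close>.\<close>

lemma ent_gap_le_truncated:
  assumes "0 \<le> z" "0 \<le> v" "v = 0 \<Longrightarrow> z = 0" "m = 0 \<Longrightarrow> z = 0" "0 \<le> m" "0 < d" "d \<le> 1" "1 \<le> K"
  shows "ent_gap z v \<le> z * max 0 (ln (z / (K * m))) + z * max 0 (ln (d * m / v))
            + (ln K - ln d + 2) * \<bar>z - v\<bar>"
proof (cases "z = 0")
  case True
  have "0 \<le> ln K" "ln d \<le> 0" using assms by auto
  then have "1 * v \<le> (ln K - ln d + 2) * v" using assms by (intro mult_right_mono) auto
  then show ?thesis using True assms by (simp add: ent_gap_def)
next
  case False
  then have p: "z > 0" "v > 0" "m > 0" using assms by (auto simp: less_le)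
  define c where "c x = max (ln d) (min (ln K) (ln (x / m)))" for x
  have dK: "ln d \<le> ln K" using assms by simp
  have c1: "ln (z / m) \<le> max 0 (ln (z / (K * m))) + c z"
    using p assms dK unfolding c_def by (simp add: ln_div ln_mult)
  have c2: "- ln (v / m) \<le> max 0 (ln (d * m / v)) - c v"
    using p assms dK unfolding c_def by (simp add: ln_div ln_mult)
  have "z * (c z - c v) - z + v \<le> (ln K - ln d + 2) * \<bar>z - v\<bar>"
  proof (cases "v \<le> z")
    case True
    have l: "ln v \<le> ln z" using True p by simp
    \<comment> \<open>Write \<open>z\<close> as \<open>v + (z - v)\<close>. The part
      \<open>v\<close> uses that clipping is 1-Lipschitz together with
      \<open>ln (z / v) \<le> z / v - 1\<close>; the part \<open>z - v\<close> uses the length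
      \<open>ln K - ln d\<close> of the clipping interval.\<close>
    have 0: "c z - c v \<le> ln K - ln d" using dK by (auto simp: c_def)
    have clip: "max a (min b y) - max a (min b x) \<le> y - x" if "x \<le> y" for a b x y :: real
      using that by linarith
    have "c z - c v \<le> ln (z / m) - ln (v / m)" unfolding c_def using p True
      by (intro clip) (simp add: divide_right_mono)
    also have "\<dots> = ln (z / v)" using p by (simp add: ln_div)
    also have "\<dots> \<le> z / v - 1" using p by (intro ln_le_minus_one) auto
    finally have "c z - c v \<le> z / v - 1" .
    then have "v * (c z - c v) \<le> v * (z / v - 1)" using p by (intro mult_left_mono) auto
    also have "v * (z / v - 1) = z - v" using p by (simp add: field_simps)
    finally have 1: "v * (c z - c v) \<le> z - v" .
    have "(z - v) * (c z - c v) \<le> (z - v) * (ln K - ln d)" using 0 True by (intro mult_left_mono) auto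
    then have "z * (c z - c v) \<le> (ln K - ln d + 1) * (z - v)" using 1 by (simp add: algebra_simps)
    then show ?thesis using True by (simp add: algebra_simps)
  next
    case False
    then have "ln (z / m) \<le> ln (v / m)" using p by (simp add: divide_right_mono)
    then have "c z \<le> c v" unfolding c_def by (intro max.mono min.mono order_refl)
    then have "z * (c z - c v) - z + v \<le> 1 * (v - z)" using p by (simp add: mult_le_0_iff)
    also have "\<dots> \<le> (ln K - ln d + 2) * (v - z)"
      by (rule mult_right_mono) (use dK False in linarith)+
    also have "v - z = \<bar>z - v\<bar>" using False by simp
    finally show ?thesis .
  qed
  moreover have "z * ln (z / v) \<le> z * (max 0 (ln (z / (K * m))) + max 0 (ln (d * m / v)) + (c z - c v))"
    using c1 c2 p by (intro mult_left_mono) (auto simp: ln_div)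
  ultimately show ?thesis by (simp add: ent_gap_def algebra_simps)
qed

lemma entropy_convexity_step:
  fixes a b k :: real
  assumes "0 \<le> a" "0 \<le> b" "0 \<le> k" "b = 0 \<or> 0 < k"
  shows "a * max 0 (ln (b / k)) + a * indicator {k<..} b
     \<le> a * max 0 (ln (a / k)) + b * indicator {k<..} b"
proof (cases "a = 0 \<or> b \<le> k")
  case True
  consider "a = 0" | "a \<noteq> 0" "b \<le> k" using True by auto
  then show ?thesis
  proof cases
    case 2
    have "ln (b / k) \<le> 0"
    proof (cases "b = 0")
      case False
      then have "0 < b" using assms(2) by linarith
      moreover have "0 < k" using assms(4) False by blast
      ultimately have "0 < b / k" "b / k \<le> 1" using 2 by (auto simp: divide_le_eq_1)
      then show ?thesis by simp
    qed simp
    then show ?thesis using 2 assms by (simp add: indicator_def)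
  qed (use assms in \<open>auto simp: indicator_def\<close>)
next
  case False
  then have p: "a > 0" "b > k" "k > 0" "b > 0" using assms by auto
  have "ln (b / a) \<le> b / a - 1" using p by (intro ln_le_minus_one) auto
  then have 1: "a * ln (b / a) \<le> b - a" using p by (simp add: field_simps)
  have 2: "a * ln (a / k) \<le> a * max 0 (ln (a / k))" using p by (intro mult_left_mono) auto
  have "max 0 (ln (b / k)) = ln (b / k)" using p by (intro max_absorb2) (auto simp: field_simps)
  moreover have "ln (b / k) = ln (b / a) + ln (a / k)" using p by (simp add: ln_div)
  ultimately have "a * max 0 (ln (b / k)) = a * ln (b / a) + a * ln (a / k)" by (simp add: distrib_left)
  moreover have "indicator {k<..} b = (1 :: real)" using p by simp
  ultimately show ?thesis using 1 2 by (simp only: mult_1_right)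
qed

section \<open>Entropy and L1 distance of filter densities\<close>

text \<open>Abstract setting: \<open>N\<close> is the law started from \<open>\<nu>\<close>, \<open>X n\<close> the state, \<open>H n\<close> the \<open>\<sigma>\<close>-field of the
  observations up to time \<open>n\<close>; \<open>g n (X n \<omega>, \<omega>)\<close> is the likelihood ratio of the two laws on
  \<open>\<sigma>(X n) \<or> H n\<close> and \<open>v n\<close> the one on \<open>H n\<close>.\<close>
locale filter_densities = prob_space N
  for N :: "'a measure" +
  fixes S :: "'s measure" and X :: "nat \<Rightarrow> 'a \<Rightarrow> 's" and H :: "nat \<Rightarrow> 'a measure"
    and g :: "nat \<Rightarrow> 's \<times> 'a \<Rightarrow> real" and v :: "nat \<Rightarrow> 'a \<Rightarrow> real"
  assumes subalg: "\<And>n. subalgebra N (H n)"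
    and H_mono: "\<And>k n. k \<le> n \<Longrightarrow> subalgebra (H n) (H k)"
    and X_meas[measurable]: "\<And>n. X n \<in> N \<rightarrow>\<^sub>M S"
    and g_meas[measurable]: "\<And>n. g n \<in> borel_measurable (S \<Otimes>\<^sub>M H n)"
    and g_nonneg: "\<And>n p. 0 \<le> g n p"
    and v_meas[measurable]: "\<And>n. v n \<in> borel_measurable (H n)"
    and v_nonneg: "\<And>n \<omega>. 0 \<le> v n \<omega>"
    and v_mass: "\<And>n. (\<integral>\<^sup>+ \<omega>. ennreal (v n \<omega>) \<partial>N) = 1"
    and markov: "\<And>k n F. k \<le> n \<Longrightarrow> F \<in> borel_measurable (S \<Otimes>\<^sub>M H n) \<Longrightarrow>
        (\<integral>\<^sup>+ \<omega>. ennreal (g k (X k \<omega>, \<omega>)) * F (X n \<omega>, \<omega>) \<partial>N)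
          = (\<integral>\<^sup>+ \<omega>. ennreal (g n (X n \<omega>, \<omega>)) * F (X n \<omega>, \<omega>) \<partial>N)"
    and obs_proj: "\<And>n F. F \<in> borel_measurable (H n) \<Longrightarrow>
        (\<integral>\<^sup>+ \<omega>. ennreal (g n (X n \<omega>, \<omega>)) * F \<omega> \<partial>N) = (\<integral>\<^sup>+ \<omega>. ennreal (v n \<omega>) * F \<omega> \<partial>N)"
begin

section \<open>Projection properties of the likelihood ratios\<close>

definition z :: "nat \<Rightarrow> 'a \<Rightarrow> real" where "z n \<omega> = g n (X n \<omega>, \<omega>)"

lemma z_nonneg: "0 \<le> z n \<omega>"
  by (simp add: z_def g_nonneg)

lemma H_measurable: "f \<in> borel_measurable (H k) \<Longrightarrow> k \<le> n \<Longrightarrow> f \<in> borel_measurable (H n)"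
  by (rule measurable_from_subalg[OF H_mono])

lemma H_N_measurable: "f \<in> borel_measurable (H k) \<Longrightarrow> f \<in> borel_measurable N"
  by (rule measurable_from_subalg[OF subalg])

lemma pair_measurable[measurable]: "(\<lambda>\<omega>. (X n \<omega>, \<omega>)) \<in> N \<rightarrow>\<^sub>M S \<Otimes>\<^sub>M H n"
proof -
  have "(\<lambda>\<omega>. \<omega>) \<in> N \<rightarrow>\<^sub>M H n"
    using subalg[of n] by (auto simp: subalgebra_def measurable_def Int_absorb2 dest: sets.sets_into_space)
  then show ?thesis by measurable
qed

lemma z_meas[measurable]: "z n \<in> borel_measurable N"
  unfolding z_def by measurable

lemma v_meas_N[measurable]: "v n \<in> borel_measurable N"
  by (rule H_N_measurable[OF v_meas])

lemma z_markov: "k \<le> n \<Longrightarrow> F \<in> borel_measurable (S \<Otimes>\<^sub>M H n) \<Longrightarrow>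
    (\<integral>\<^sup>+ \<omega>. ennreal (z k \<omega>) * F (X n \<omega>, \<omega>) \<partial>N) = (\<integral>\<^sup>+ \<omega>. ennreal (z n \<omega>) * F (X n \<omega>, \<omega>) \<partial>N)"
  unfolding z_def by (rule markov)

lemma z_obs: "F \<in> borel_measurable (H n) \<Longrightarrow>
    (\<integral>\<^sup>+ \<omega>. ennreal (z n \<omega>) * F \<omega> \<partial>N) = (\<integral>\<^sup>+ \<omega>. ennreal (v n \<omega>) * F \<omega> \<partial>N)"
  unfolding z_def by (rule obs_proj)

text \<open>The projection of \<open>z n\<close> on the observations up to an earlier time
  \<open>k\<close> is \<open>v k\<close>: \<open>z_markov\<close> replaces \<open>z n\<close> by
  \<open>z k\<close> against any observable of time \<open>n\<close>, and \<open>z_obs\<close> then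
  projects at time \<open>k\<close>.\<close>

lemma z_obs_earlier:
  assumes "k \<le> n" and F: "F \<in> borel_measurable (H k)"
  shows "(\<integral>\<^sup>+ \<omega>. ennreal (z n \<omega>) * F \<omega> \<partial>N) = (\<integral>\<^sup>+ \<omega>. ennreal (v k \<omega>) * F \<omega> \<partial>N)"
proof -
  have Fn: "F \<in> borel_measurable (H n)" by (rule H_measurable[OF F assms(1)])
  have "(\<integral>\<^sup>+ \<omega>. ennreal (z k \<omega>) * F (snd (X n \<omega>, \<omega>)) \<partial>N) = (\<integral>\<^sup>+ \<omega>. ennreal (z n \<omega>) * F (snd (X n \<omega>, \<omega>)) \<partial>N)"
    by (rule z_markov[OF assms(1)]) (rule measurable_compose[OF measurable_snd], fact)
  then show ?thesis using z_obs[OF F] by simp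
qed

lemma z_mass: "(\<integral>\<^sup>+ \<omega>. z n \<omega> \<partial>N) = 1"
  using z_obs[of "\<lambda>_. 1" n] v_mass by simp

text \<open>The mass of \<open>z n\<close> on the event \<open>v k = 0\<close> equals the mass of
  \<open>v k\<close> there, which is zero. This makes the quotients by \<open>v k\<close> and
  \<open>v n\<close> below meaningful almost everywhere.\<close>

lemma AE_z_zero: "k \<le> n \<Longrightarrow> AE \<omega> in N. v k \<omega> = 0 \<longrightarrow> z n \<omega> = 0"
proof -
  assume kn: "k \<le> n"
  have "(\<integral>\<^sup>+ \<omega>. ennreal (z n \<omega>) * indicator {0} (v k \<omega>) \<partial>N) = (\<integral>\<^sup>+ \<omega>. ennreal (v k \<omega>) * indicator {0} (v k \<omega>) \<partial>N)"
    by (rule z_obs_earlier[OF kn]) measurable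
  also have "\<dots> = (\<integral>\<^sup>+ \<omega>. 0 \<partial>N)" by (intro nn_integral_cong) (auto simp: indicator_def)
  finally have "AE \<omega> in N. ennreal (z n \<omega>) * indicator {0} (v k \<omega>) = 0"
    by (simp add: nn_integral_0_iff_AE)
  then show ?thesis by eventually_elim (auto simp: indicator_def z_nonneg order_antisym[OF _ z_nonneg])
qed

section \<open>Comparing the entropy gap with the L1 gap\<close>

abbreviation entropy_gap :: "nat \<Rightarrow> ennreal" where
  "entropy_gap n \<equiv> \<integral>\<^sup>+ \<omega>. ent_gap (z n \<omega>) (v n \<omega>) \<partial>N"

abbreviation L1_gap :: "nat \<Rightarrow> ennreal" where
  "L1_gap n \<equiv> \<integral>\<^sup>+ \<omega>. \<bar>z n \<omega> - v n \<omega>\<bar> \<partial>N"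

lemma ent_gap_meas[measurable]: "(\<lambda>\<omega>. ent_gap (z n \<omega>) (v n \<omega>)) \<in> borel_measurable N"
  unfolding ent_gap_def by measurable

lemma L1_gap_le_entropy_gap:
  assumes "0 < e"
  shows "L1_gap n \<le> ennreal e + ennreal (1 + 1 / e) * entropy_gap n"
proof -
  have "L1_gap n \<le> (\<integral>\<^sup>+ \<omega>. ennreal e * ennreal (v n \<omega>) + ennreal (1 + 1/e) * ennreal (ent_gap (z n \<omega>) (v n \<omega>)) \<partial>N)"
  proof (intro nn_integral_mono_AE)
    show "AE \<omega> in N. ennreal \<bar>z n \<omega> - v n \<omega>\<bar> \<le> ennreal e * ennreal (v n \<omega>) + ennreal (1 + 1/e) * ennreal (ent_gap (z n \<omega>) (v n \<omega>))"
      using AE_z_zero[OF order_refl, of n]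
    proof eventually_elim
      case (elim \<omega>)
      then have "0 \<le> ent_gap (z n \<omega>) (v n \<omega>)" by (intro ent_gap_nonneg z_nonneg v_nonneg) auto
      moreover have "ennreal \<bar>z n \<omega> - v n \<omega>\<bar> \<le> ennreal (e * v n \<omega> + (1 + 1/e) * ent_gap (z n \<omega>) (v n \<omega>))"
        using elim assms by (intro ennreal_leI abs_diff_le_ent_gap z_nonneg v_nonneg) auto
      ultimately show ?case using assms v_nonneg
        by (simp add: ennreal_plus[symmetric] ennreal_mult[symmetric] del: ennreal_plus)
    qed
  qed
  also have "\<dots> = ennreal e + ennreal (1 + 1 / e) * entropy_gap n"
    by (simp add: nn_integral_add nn_integral_cmult v_mass)
  finally show ?thesis .
qed

abbreviation tail :: "nat \<Rightarrow> real \<Rightarrow> 'a \<Rightarrow> nat \<Rightarrow> real" where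
  "tail k K \<omega> n \<equiv> z n \<omega> * max 0 (ln (z n \<omega> / (K * v k \<omega>)))"

text \<open>Conditional Jensen for \<open>x \<mapsto> max 0 (x ln (x / K))\<close>: by the Markov property \<open>z n\<close> is a projection of \<open>z k\<close>.
  Proved by integrating a tangent inequality, so that only nonnegative integrands occur.\<close>
lemma tail_le:
  assumes kn: "k \<le> n" and K: "0 < K"
  shows "(\<integral>\<^sup>+ \<omega>. tail k K \<omega> n \<partial>N) \<le> (\<integral>\<^sup>+ \<omega>. tail k K \<omega> k \<partial>N)"
proof -
  have v[measurable]: "v k \<in> borel_measurable (H n)" by (rule H_measurable[OF _ kn]) measurable
  \<comment> \<open>\<open>F\<close> and \<open>I\<close> are the two pieces of the tangent slope at
    \<open>z n\<close>. They are written as functions on the product space so that they are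
    admissible test functions in \<open>z_markov\<close>.\<close>
  define F where "F p = max 0 (ln (g n p / (K * v k (snd p))))" for p
  define I where "I p = (indicator {K * v k (snd p)<..} (g n p) :: real)" for p
  have v': "(\<lambda>p. K * v k (snd p)) \<in> borel_measurable (S \<Otimes>\<^sub>M H n)"
    by (intro borel_measurable_times borel_measurable_const measurable_compose[OF measurable_snd v])
  have [measurable]: "F \<in> borel_measurable (S \<Otimes>\<^sub>M H n)"
    unfolding F_def by (intro borel_measurable_max borel_measurable_const borel_measurable_ln
      borel_measurable_divide g_meas v')
  have [measurable]: "I \<in> borel_measurable (S \<Otimes>\<^sub>M H n)"
    unfolding I_def indicator_def of_bool_def greaterThan_iff
    by (intro measurable_If borel_measurable_less v' g_meas borel_measurable_const)
  have FI: "0 \<le> F p" "0 \<le> I p" "I p \<le> 1" for p by (auto simp: F_def I_def indicator_def)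
  have 1: "(\<integral>\<^sup>+ \<omega>. ennreal (z k \<omega>) * ennreal (F (X n \<omega>, \<omega>)) \<partial>N) = (\<integral>\<^sup>+ \<omega>. ennreal (z n \<omega>) * ennreal (F (X n \<omega>, \<omega>)) \<partial>N)"
    by (rule z_markov[OF kn, of "\<lambda>p. ennreal (F p)"]) measurable
  have 2: "(\<integral>\<^sup>+ \<omega>. ennreal (z k \<omega>) * ennreal (I (X n \<omega>, \<omega>)) \<partial>N) = (\<integral>\<^sup>+ \<omega>. ennreal (z n \<omega>) * ennreal (I (X n \<omega>, \<omega>)) \<partial>N)"
    by (rule z_markov[OF kn, of "\<lambda>p. ennreal (I p)"]) measurable
  \<comment> \<open>Finiteness of this term, which is at most the total mass of \<open>z n\<close>,
    is what permits cancelling it at the end.\<close>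
  have fin: "(\<integral>\<^sup>+ \<omega>. ennreal (z n \<omega>) * ennreal (I (X n \<omega>, \<omega>)) \<partial>N) \<noteq> \<infinity>"
  proof -
    have "(\<integral>\<^sup>+ \<omega>. ennreal (z n \<omega>) * ennreal (I (X n \<omega>, \<omega>)) \<partial>N) \<le> (\<integral>\<^sup>+ \<omega>. ennreal (z n \<omega>) * 1 \<partial>N)"
      using FI by (intro nn_integral_mono mult_left_mono) auto
    then show ?thesis using z_mass[of n] by (auto simp: top_unique)
  qed
  \<comment> \<open>By the Markov property \<open>F\<close> and \<open>I\<close> integrate equally
    against \<open>z n\<close> and \<open>z k\<close>. The tangent inequality trades the indicator
    term of \<open>z k\<close> for that of \<open>z n\<close>, so this term stands on both sides in
    the end.\<close>
  have "(\<integral>\<^sup>+ \<omega>. tail k K \<omega> n \<partial>N) + (\<integral>\<^sup>+ \<omega>. ennreal (z n \<omega>) * ennreal (I (X n \<omega>, \<omega>)) \<partial>N)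
      = (\<integral>\<^sup>+ \<omega>. ennreal (z k \<omega>) * ennreal (F (X n \<omega>, \<omega>)) \<partial>N) + (\<integral>\<^sup>+ \<omega>. ennreal (z k \<omega>) * ennreal (I (X n \<omega>, \<omega>)) \<partial>N)"
    unfolding 1 2 by (intro arg_cong2[where f="(+)"] nn_integral_cong refl)
      (simp add: F_def z_def[symmetric] ennreal_mult z_nonneg)
  also have "\<dots> = (\<integral>\<^sup>+ \<omega>. ennreal (z k \<omega>) * ennreal (F (X n \<omega>, \<omega>)) + ennreal (z k \<omega>) * ennreal (I (X n \<omega>, \<omega>)) \<partial>N)"
    by (subst nn_integral_add) auto
  also have "\<dots> \<le> (\<integral>\<^sup>+ \<omega>. tail k K \<omega> k + ennreal (z n \<omega>) * ennreal (I (X n \<omega>, \<omega>)) \<partial>N)"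
  proof (intro nn_integral_mono_AE)
    show "AE \<omega> in N. ennreal (z k \<omega>) * ennreal (F (X n \<omega>, \<omega>)) + ennreal (z k \<omega>) * ennreal (I (X n \<omega>, \<omega>))
            \<le> ennreal (tail k K \<omega> k) + ennreal (z n \<omega>) * ennreal (I (X n \<omega>, \<omega>))"
      using AE_z_zero[OF kn]
    proof eventually_elim
      case (elim \<omega>)
      have "z k \<omega> * F (X n \<omega>, \<omega>) + z k \<omega> * I (X n \<omega>, \<omega>) \<le> tail k K \<omega> k + z n \<omega> * I (X n \<omega>, \<omega>)"
        unfolding F_def I_def snd_conv z_def[symmetric]
        by (rule entropy_convexity_step) (use elim K v_nonneg[of k \<omega>] z_nonneg in \<open>auto simp: less_le\<close>)
      then have "ennreal (z k \<omega> * F (X n \<omega>, \<omega>) + z k \<omega> * I (X n \<omega>, \<omega>)) \<le> ennreal (tail k K \<omega> k + z n \<omega> * I (X n \<omega>, \<omega>))"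
        by (rule ennreal_leI)
      then show ?case using FI z_nonneg by (simp add: ennreal_mult)
    qed
  qed
  also have "\<dots> = (\<integral>\<^sup>+ \<omega>. tail k K \<omega> k \<partial>N) + (\<integral>\<^sup>+ \<omega>. ennreal (z n \<omega>) * ennreal (I (X n \<omega>, \<omega>)) \<partial>N)"
    by (subst nn_integral_add) auto
  finally have le: "(\<integral>\<^sup>+ \<omega>. tail k K \<omega> n \<partial>N) + (\<integral>\<^sup>+ \<omega>. ennreal (z n \<omega>) * ennreal (I (X n \<omega>, \<omega>)) \<partial>N)
      \<le> (\<integral>\<^sup>+ \<omega>. tail k K \<omega> k \<partial>N) + (\<integral>\<^sup>+ \<omega>. ennreal (z n \<omega>) * ennreal (I (X n \<omega>, \<omega>)) \<partial>N)" .
  have cancel: "a \<le> b" if "a + c \<le> b + c" "c \<noteq> \<infinity>" for a b c :: ennreal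
    using that ennreal_add_left_cancel_le[of c a b] by (simp only: add.commute) simp
  show ?thesis by (rule cancel[OF le fin])
qed

text \<open>Integrates \<open>ent_gap_le_truncated\<close> with \<open>m = v k\<close>. The first
  two terms of the bound do not depend on \<open>n\<close>, which is the uniform integrability that
  upgrades L1 convergence to convergence in entropy.\<close>

lemma entropy_gap_le_truncated:
  assumes kn: "k \<le> n" and d: "0 < d" "d \<le> 1" and K: "1 \<le> K"
  shows "entropy_gap n \<le> (\<integral>\<^sup>+ \<omega>. tail k K \<omega> k \<partial>N) + ennreal d + ennreal (ln K - ln d + 2) * L1_gap n"
proof -
  define F where "F \<omega> = max 0 (ln (d * v k \<omega> / v n \<omega>))" for \<omega>
  have v[measurable]: "v k \<in> borel_measurable (H n)" by (rule H_measurable[OF _ kn]) measurable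
  have F: "F \<in> borel_measurable (H n)"
    unfolding F_def by (intro borel_measurable_max borel_measurable_const borel_measurable_ln
      borel_measurable_divide borel_measurable_times v v_meas)
  have [measurable]: "F \<in> borel_measurable N" by (rule H_N_measurable) fact
  have F0: "0 \<le> F \<omega>" for \<omega> by (simp add: F_def)
  have C: "0 \<le> ln K - ln d + 2"
  proof -
    have "0 \<le> ln K" "ln d \<le> 0" using d K by auto
    then show ?thesis by simp
  qed
  \<comment> \<open>\<open>F\<close> is observable at time \<open>n\<close>, so \<open>z n\<close>
    may be replaced by \<open>v n\<close>. Then \<open>x * ln (y / x) \<le> y\<close> with
    \<open>y = d * v k\<close> gives the bound, as \<open>v k\<close> has mass one.\<close>
  have 1: "(\<integral>\<^sup>+ \<omega>. ennreal (z n \<omega>) * ennreal (F \<omega>) \<partial>N) \<le> ennreal d"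
  proof -
    have "(\<integral>\<^sup>+ \<omega>. ennreal (z n \<omega>) * ennreal (F \<omega>) \<partial>N) = (\<integral>\<^sup>+ \<omega>. ennreal (v n \<omega>) * ennreal (F \<omega>) \<partial>N)"
      by (rule z_obs) (rule measurable_compose[OF F measurable_ennreal])
    also have "\<dots> \<le> (\<integral>\<^sup>+ \<omega>. ennreal d * ennreal (v k \<omega>) \<partial>N)"
    proof (intro nn_integral_mono)
      fix \<omega>
      have "v n \<omega> * F \<omega> \<le> d * v k \<omega>"
      \<comment> \<open>When \<open>v n\<close> vanishes so does the product, and when only
        \<open>v k\<close> vanishes \<open>F\<close> is zero because
        \<open>ln 0 = 0\<close>.\<close>
      proof (cases "v n \<omega> = 0 \<or> v k \<omega> = 0")
        case False
        then have p: "v n \<omega> > 0" "v k \<omega> > 0" using v_nonneg[of n \<omega>] v_nonneg[of k \<omega>] by (auto simp: less_le)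
        have "ln (d * v k \<omega> / v n \<omega>) \<le> d * v k \<omega> / v n \<omega> - 1" using p d by (intro ln_le_minus_one) auto
        moreover have "0 \<le> d * v k \<omega> / v n \<omega>" using p d by auto
        ultimately have "F \<omega> \<le> d * v k \<omega> / v n \<omega>" by (simp add: F_def)
        then show ?thesis using p by (simp add: field_simps)
      qed (use d v_nonneg in \<open>auto simp: F_def\<close>)
      then have "ennreal (v n \<omega> * F \<omega>) \<le> ennreal (d * v k \<omega>)" by (rule ennreal_leI)
      then show "ennreal (v n \<omega>) * ennreal (F \<omega>) \<le> ennreal d * ennreal (v k \<omega>)"
        using d v_nonneg F0 by (simp add: ennreal_mult)
    qed
    also have "\<dots> = ennreal d" by (simp add: nn_integral_cmult v_mass)
    finally show ?thesis .
  qed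
  have 2: "(\<integral>\<^sup>+ \<omega>. tail k K \<omega> n \<partial>N) \<le> (\<integral>\<^sup>+ \<omega>. tail k K \<omega> k \<partial>N)"
    using K by (intro tail_le[OF kn]) auto
  have "entropy_gap n \<le> (\<integral>\<^sup>+ \<omega>. tail k K \<omega> n + ennreal (z n \<omega>) * ennreal (F \<omega>) + ennreal (ln K - ln d + 2) * ennreal \<bar>z n \<omega> - v n \<omega>\<bar> \<partial>N)"
  proof (intro nn_integral_mono_AE)
    show "AE \<omega> in N. ennreal (ent_gap (z n \<omega>) (v n \<omega>)) \<le> ennreal (tail k K \<omega> n) + ennreal (z n \<omega>) * ennreal (F \<omega>)
          + ennreal (ln K - ln d + 2) * ennreal \<bar>z n \<omega> - v n \<omega>\<bar>"
      using AE_z_zero[OF kn] AE_z_zero[OF order_refl, of n]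
    proof eventually_elim
      case (elim \<omega>)
      have "ent_gap (z n \<omega>) (v n \<omega>) \<le> tail k K \<omega> n + z n \<omega> * F \<omega> + (ln K - ln d + 2) * \<bar>z n \<omega> - v n \<omega>\<bar>"
        unfolding F_def by (rule ent_gap_le_truncated) (use elim d K z_nonneg v_nonneg in auto)
      then have "ennreal (ent_gap (z n \<omega>) (v n \<omega>)) \<le> ennreal (tail k K \<omega> n + z n \<omega> * F \<omega> + (ln K - ln d + 2) * \<bar>z n \<omega> - v n \<omega>\<bar>)"
        by (rule ennreal_leI)
      then show ?case using F0 C z_nonneg by (simp add: ennreal_mult)
    qed
  qed
  also have "\<dots> = (\<integral>\<^sup>+ \<omega>. tail k K \<omega> n \<partial>N) + (\<integral>\<^sup>+ \<omega>. ennreal (z n \<omega>) * ennreal (F \<omega>) \<partial>N) + ennreal (ln K - ln d + 2) * L1_gap n"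
    by (simp add: nn_integral_add nn_integral_cmult)
  also have "\<dots> \<le> (\<integral>\<^sup>+ \<omega>. tail k K \<omega> k \<partial>N) + ennreal d + ennreal (ln K - ln d + 2) * L1_gap n"
    by (intro add_mono 1 2 order_refl)
  finally show ?thesis .
qed

text \<open>Dominated convergence. For levels at least one the tail is below
  \<open>ent_gap (z k \<omega>) (v k \<omega>) + z k \<omega>\<close>, which is integrable by the
  finiteness assumption. Pointwise the tail is exactly zero once the level exceeds
  \<open>z k \<omega> / v k \<omega>\<close>. The levels \<open>Suc i\<close> keep
  \<open>K \<ge> 1\<close>.\<close>

lemma tail_tendsto_0:
  assumes fin: "entropy_gap k < \<infinity>"
  shows "(\<lambda>i. \<integral>\<^sup>+ \<omega>. tail k (real (Suc i)) \<omega> k \<partial>N) \<longlonglongrightarrow> 0"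
proof -
  have "(\<lambda>i. \<integral>\<^sup>+ \<omega>. tail k (real (Suc i)) \<omega> k \<partial>N) \<longlonglongrightarrow> (\<integral>\<^sup>+ \<omega>. 0 \<partial>N)"
  proof (rule nn_integral_dominated_convergence)
    show "(\<integral>\<^sup>+ \<omega>. ennreal (ent_gap (z k \<omega>) (v k \<omega>)) + ennreal (z k \<omega>) \<partial>N) < \<infinity>"
      using fin by (simp add: nn_integral_add z_mass)
    show "AE \<omega> in N. ennreal (tail k (real (Suc i)) \<omega> k) \<le> ennreal (ent_gap (z k \<omega>) (v k \<omega>)) + ennreal (z k \<omega>)" for i
      using AE_z_zero[OF order_refl, of k]
    proof eventually_elim
      case (elim \<omega>)
      have g0: "0 \<le> ent_gap (z k \<omega>) (v k \<omega>)" by (rule ent_gap_nonneg) (use elim z_nonneg v_nonneg in auto)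
      have "tail k (real (Suc i)) \<omega> k \<le> ent_gap (z k \<omega>) (v k \<omega>) + z k \<omega>"
      proof (cases "z k \<omega> = 0")
        case False
        then have p: "z k \<omega> > 0" "v k \<omega> > 0" using elim z_nonneg[of k \<omega>] v_nonneg[of k \<omega>] by (auto simp: less_le)
        have "ln (z k \<omega> / (real (Suc i) * v k \<omega>)) = ln (z k \<omega> / v k \<omega>) - ln (real (Suc i))"
          using p by (simp add: ln_div ln_mult)
        moreover have "0 \<le> ln (real (Suc i))" by simp
        ultimately have "z k \<omega> * ln (z k \<omega> / (real (Suc i) * v k \<omega>)) \<le> z k \<omega> * ln (z k \<omega> / v k \<omega>)"
          using p by (intro mult_left_mono) auto
        then have "z k \<omega> * ln (z k \<omega> / (real (Suc i) * v k \<omega>)) \<le> ent_gap (z k \<omega>) (v k \<omega>) + z k \<omega>"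
          using p unfolding ent_gap_def by linarith
        then show ?thesis using p g0 unfolding max_def by auto
      qed (use g0 in auto)
      then have "ennreal (tail k (real (Suc i)) \<omega> k) \<le> ennreal (ent_gap (z k \<omega>) (v k \<omega>) + z k \<omega>)" by (rule ennreal_leI)
      then show ?case using g0 z_nonneg by simp
    qed
    show "AE \<omega> in N. (\<lambda>i. ennreal (tail k (real (Suc i)) \<omega> k)) \<longlonglongrightarrow> 0"
      using AE_z_zero[OF order_refl, of k]
    proof eventually_elim
      case (elim \<omega>)
      have "eventually (\<lambda>i. ennreal (tail k (real (Suc i)) \<omega> k) = 0) sequentially"
      proof (cases "z k \<omega> = 0")
        case False
        then have p: "z k \<omega> > 0" "v k \<omega> > 0" using elim z_nonneg[of k \<omega>] v_nonneg[of k \<omega>] by (auto simp: less_le)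
        obtain j where j: "z k \<omega> / v k \<omega> < real j" using reals_Archimedean2 by blast
        show ?thesis using eventually_ge_at_top[of j]
        proof eventually_elim
          case (elim i)
          then have "z k \<omega> / v k \<omega> < real (Suc i)" using j by auto
          then have "z k \<omega> / (real (Suc i) * v k \<omega>) \<le> 1" using p by (simp add: field_simps)
          moreover have "0 < z k \<omega> / (real (Suc i) * v k \<omega>)" using p by simp
          ultimately have "ln (z k \<omega> / (real (Suc i) * v k \<omega>)) \<le> 0" by (subst ln_le_zero_iff)
          then have "max 0 (ln (z k \<omega> / (real (Suc i) * v k \<omega>))) = 0" by (rule max_absorb1)
          then show ?case by simp
        qed
      qed simp
      then show ?case by (rule tendsto_eventually)
    qed
  qed auto
  then show ?thesis by simp
qed

text \<open>For the converse direction the order of choices matters: first \<open>d\<close>, then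
  \<open>K\<close> making the tail at time \<open>k\<close> small, and only then \<open>n\<close>,
  because the coefficient of \<open>L1_gap n\<close> depends on both \<open>d\<close> and
  \<open>K\<close>.\<close>

theorem entropy_gap_tendsto_iff:
  assumes fin: "entropy_gap k < \<infinity>"
  shows "entropy_gap \<longlonglongrightarrow> 0 \<longleftrightarrow> L1_gap \<longlonglongrightarrow> 0"
proof
  \<comment> \<open>It suffices to test convergence with real bounds at most one; this keeps the
    estimates finite and secures \<open>d \<le> 1\<close> below.\<close>
  have *: "f \<longlonglongrightarrow> 0" if "\<And>e::real. 0 < e \<Longrightarrow> e \<le> 1 \<Longrightarrow> eventually (\<lambda>n. f n < ennreal e) sequentially" for f :: "nat \<Rightarrow> ennreal"
  proof (rule order_tendstoI)
    fix a :: ennreal assume "0 < a"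
    then have "0 < min a 1" by simp
    then obtain b where b: "0 < b" "b < min a 1" using dense by blast
    then have b1: "b < 1" "b < a" by simp_all
    have "b < top" using b1(1) ennreal_one_less_top by (rule order.strict_trans)
    define e where "e = enn2real b"
    have be: "ennreal e = b" using \<open>b < top\<close> by (simp add: e_def)
    have "ennreal 0 < ennreal e" "ennreal e < ennreal 1" using b(1) b1(1) by (simp_all only: be ennreal_0 ennreal_1)
    then have e: "0 < e" "e \<le> 1" by (simp_all add: ennreal_less_iff e_def)
    have ea: "ennreal e \<le> a" using b1(2) be by simp
    show "eventually (\<lambda>n. f n < a) sequentially"
      using that[OF e] by eventually_elim (rule less_le_trans[OF _ ea])
  qed auto
  have small: "eventually (\<lambda>n. ennreal C * f n < ennreal e) sequentially" if "f \<longlonglongrightarrow> 0" "0 < e" for f :: "nat \<Rightarrow> ennreal" and C e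
  proof -
    have "(\<lambda>n. ennreal C * f n) \<longlonglongrightarrow> ennreal C * 0" by (rule tendsto_mult_ennreal) (use that in auto)
    then show ?thesis using that(2) by (intro order_tendstoD) auto
  qed
  { assume E: "entropy_gap \<longlonglongrightarrow> 0"
    show "L1_gap \<longlonglongrightarrow> 0"
    proof (rule *)
      fix e :: real assume e: "0 < e" "e \<le> 1"
      show "eventually (\<lambda>n. L1_gap n < ennreal e) sequentially"
        using small[OF E, of "e/2" "1 + 1/(e/2)", OF half_gt_zero[OF e(1)]]
      proof eventually_elim
        case (elim n)
        have "L1_gap n \<le> ennreal (e/2) + ennreal (1 + 1 / (e/2)) * entropy_gap n"
          by (rule L1_gap_le_entropy_gap) (use e in auto)
        also have "\<dots> < ennreal (e/2) + ennreal (e/2)" using elim e by (simp add: ennreal_add_left_cancel_less)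
        also have "\<dots> = ennreal e" using e by (simp flip: ennreal_plus)
        finally show ?case .
      qed
    qed }
  { assume T: "L1_gap \<longlonglongrightarrow> 0"
    show "entropy_gap \<longlonglongrightarrow> 0"
    proof (rule *)
      fix e :: real assume e: "0 < e" "e \<le> 1"
      \<comment> \<open>One third for each of the three terms in
        \<open>entropy_gap_le_truncated\<close>.\<close>
      define d where "d = e / 3"
      have d: "0 < d" "d \<le> 1" using e by (auto simp: d_def)
      have "eventually (\<lambda>i. (\<integral>\<^sup>+ \<omega>. tail k (real (Suc i)) \<omega> k \<partial>N) < ennreal d) sequentially"
        using tail_tendsto_0[OF fin] d by (intro order_tendstoD) auto
      then obtain i where i: "(\<integral>\<^sup>+ \<omega>. tail k (real (Suc i)) \<omega> k \<partial>N) < ennreal d"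
        by (auto simp: eventually_sequentially)
      define K where "K = real (Suc i)"
      show "eventually (\<lambda>n. entropy_gap n < ennreal e) sequentially"
        using small[OF T d(1), of "ln K - ln d + 2"] eventually_ge_at_top[of k]
      proof eventually_elim
        case (elim n)
        have "entropy_gap n \<le> (\<integral>\<^sup>+ \<omega>. tail k K \<omega> k \<partial>N) + ennreal d + ennreal (ln K - ln d + 2) * L1_gap n"
          by (rule entropy_gap_le_truncated) (use elim d in \<open>auto simp: K_def\<close>)
        also have "\<dots> \<le> ennreal d + ennreal d + ennreal (ln K - ln d + 2) * L1_gap n"
          using i by (intro add_right_mono) (simp add: K_def)
        also have "\<dots> < ennreal d + ennreal d + ennreal d"
          using elim d by (simp add: ennreal_add_left_cancel_less)
        also have "\<dots> = ennreal e" using e by (simp add: d_def flip: ennreal_plus)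
        finally show ?case .
      qed
    qed }
qed

end

section \<open>Relative entropy and total variation through densities\<close>

text \<open>Relative entropy is defined as a difference \<open>A - B\<close> of a positive and a
  negative part. Integrating the pointwise identity that links \<open>ent_gap (r x) 1\<close> with
  these parts gives \<open>?E + B + 1 = A + 1\<close>, where the \<open>1\<close> on the left is the
  mass of \<open>P\<close> and that on the right the mass of \<open>R\<close>. The subtraction is
  legitimate because \<open>- r ln r \<le> 1\<close> makes \<open>B\<close> finite, and
  \<open>e2ennreal\<close> loses nothing because the result is nonnegative.\<close>

lemma rel_entropy_density:
  assumes "prob_space R" "prob_space P" and r[measurable]: "r \<in> borel_measurable R"
    and r0: "\<And>x. 0 \<le> r x" and P: "P = density R (\<lambda>x. ennreal (r x))"
  shows "e2ennreal (rel_entropy P R) = (\<integral>\<^sup>+ x. ent_gap (r x) 1 \<partial>R)"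
proof -
  interpret R: prob_space R by fact
  interpret P: prob_space P by fact
  have sP: "sets P = sets R" by (simp add: P)
  have ac: "absolutely_continuous R P" unfolding P by (rule absolutely_continuousI_density) measurable
  have RN: "AE x in R. RN_deriv R P x = ennreal (r x)"
    using R.RN_deriv_unique[of "\<lambda>x. ennreal (r x)" P] by (auto simp: P elim: AE_mp)
  have mass: "(\<integral>\<^sup>+ x. ennreal (r x) \<partial>R) = 1"
    using P.emeasure_space_1 by (simp add: P emeasure_density cong: nn_integral_cong)
  have int: "(\<integral>\<^sup>+ x. ennreal (f (enn2real (RN_deriv R P x))) \<partial>P) = (\<integral>\<^sup>+ x. ennreal (r x * f (r x)) \<partial>R)"
    if f[measurable]: "f \<in> borel_measurable borel" for f :: "real \<Rightarrow> real"
  proof -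
    have "(\<integral>\<^sup>+ x. ennreal (f (enn2real (RN_deriv R P x))) \<partial>P)
        = (\<integral>\<^sup>+ x. ennreal (r x) * ennreal (f (enn2real (RN_deriv R P x))) \<partial>R)"
      by (subst P, rule nn_integral_density) measurable
    also have "\<dots> = (\<integral>\<^sup>+ x. ennreal (r x * f (r x)) \<partial>R)"
      using RN by (intro nn_integral_cong_AE) (auto simp: r0 ennreal_mult')
    finally show ?thesis .
  qed
  define A where "A = (\<integral>\<^sup>+ x. ennreal (r x * ln (r x)) \<partial>R)"
  define B where "B = (\<integral>\<^sup>+ x. ennreal (r x * - ln (r x)) \<partial>R)"
  let ?E = "\<integral>\<^sup>+ x. ennreal (ent_gap (r x) 1) \<partial>R"
  have [measurable]: "(\<lambda>x. ent_gap (r x) 1) \<in> borel_measurable R" unfolding ent_gap_def by measurable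
  have g0: "0 \<le> ent_gap (r x) 1" for x by (rule ent_gap_nonneg) (auto simp: r0)
  have "?E + B + 1 = (\<integral>\<^sup>+ x. ennreal (ent_gap (r x) 1) + ennreal (r x * - ln (r x)) + ennreal (r x) \<partial>R)"
    by (simp add: nn_integral_add mass B_def)
  also have "\<dots> = (\<integral>\<^sup>+ x. ennreal (r x * ln (r x)) + 1 \<partial>R)"
  proof (rule nn_integral_cong)
    fix x
    have "ent_gap (r x) 1 = r x * ln (r x) - r x + 1" by (simp add: ent_gap_def)
    then have eq: "ent_gap (r x) 1 + max 0 (r x * - ln (r x)) + r x = max 0 (r x * ln (r x)) + 1"
      unfolding max_def by auto
    have "ennreal (ent_gap (r x) 1) + ennreal (r x * - ln (r x)) + ennreal (r x)
       = ennreal (ent_gap (r x) 1 + max 0 (r x * - ln (r x)) + r x)"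
      using g0 r0 by (simp add: max_def ennreal_neg)
    also have "\<dots> = ennreal (max 0 (r x * ln (r x)) + 1)" by (simp only: eq)
    also have "\<dots> = ennreal (r x * ln (r x)) + 1" by (simp add: max_def ennreal_neg)
    finally show "ennreal (ent_gap (r x) 1) + ennreal (r x * - ln (r x)) + ennreal (r x) = ennreal (r x * ln (r x)) + 1" .
  qed
  also have "\<dots> = A + 1" by (simp add: nn_integral_add A_def R.emeasure_space_1)
  finally have "?E + B = A" by (metis add.commute ennreal_add_left_cancel infinity_ennreal_def ennreal_one_neq_top)
  moreover have "B \<le> (\<integral>\<^sup>+ x. 1 \<partial>R)" unfolding B_def
  proof (rule nn_integral_mono)
    fix x
    have "r x * - ln (r x) \<le> 1" using g0[of x] r0[of x] by (simp add: ent_gap_def)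
    then show "ennreal (r x * - ln (r x)) \<le> 1" by (simp add: ennreal_le_1)
  qed
  then have "B < top" by (simp add: R.emeasure_space_1 le_less_trans[OF _ ennreal_one_less_top])
  then have "\<bar>enn2ereal B\<bar> \<noteq> \<infinity>" by (cases B) (auto simp: enn2ereal_ennreal)
  moreover have "rel_entropy P R = enn2ereal A - enn2ereal B"
    unfolding rel_entropy_def using int[of ln] int[of "\<lambda>x. - ln x"] sP ac by (simp add: A_def B_def)
  ultimately have "rel_entropy P R = enn2ereal ?E"
    by (metis ereal_diff_add_inverse plus_ennreal.rep_eq add.commute)
  then show ?thesis by simp
qed

text \<open>The supremum is attained at the sign of \<open>r - 1\<close>. With test functions
  bounded by one in absolute value this yields the full L1 distance, without a factor one
  half.\<close>

lemma tv_dist_density: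
  fixes R P :: "'a measure"
  assumes "prob_space R" "prob_space P" and r[measurable]: "r \<in> borel_measurable R"
    and r0: "\<And>x. 0 \<le> r x" and P: "P = density R (\<lambda>x. ennreal (r x))"
  shows "ennreal (tv_dist P R) = (\<integral>\<^sup>+ x. \<bar>r x - 1\<bar> \<partial>R)"
proof -
  interpret R: prob_space R by fact
  interpret P: prob_space P by fact
  have mass: "(\<integral>\<^sup>+ x. ennreal (r x) \<partial>R) = 1"
    using P.emeasure_space_1 by (simp add: P emeasure_density cong: nn_integral_cong)
  have ir: "integrable R r" using mass by (intro integrableI_nonneg) (auto simp: r0)
  then have id: "integrable R (\<lambda>x. \<bar>r x - 1\<bar>)" by auto
  have meas: "borel_measurable P = (borel_measurable R :: ('a \<Rightarrow> real) set)"
    by (rule measurable_cong_sets) (simp_all add: P)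
  have diff: "(\<integral>x. f x \<partial>P) - (\<integral>x. f x \<partial>R) = (\<integral>x. (r x - 1) * f x \<partial>R)"
    if [measurable]: "f \<in> borel_measurable R" and f: "\<And>x. \<bar>f x\<bar> \<le> 1" for f
  proof -
    have "integrable R f" by (rule R.integrable_const_bound[where B=1]) (use f in auto)
    moreover have "integrable R (\<lambda>x. r x * f x)"
      by (rule Bochner_Integration.integrable_bound[OF ir])
        (use f r0 in \<open>auto simp: abs_mult intro!: mult_left_le\<close>)
    moreover have "(\<integral>x. f x \<partial>P) = (\<integral>x. r x * f x \<partial>R)"
      unfolding P by (subst integral_density) (auto simp: r0)
    ultimately show ?thesis by (simp add: algebra_simps)
  qed
  have "tv_dist P R = (\<integral>x. \<bar>r x - 1\<bar> \<partial>R)"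
    unfolding tv_dist_def meas
  proof (rule cSup_eq_maximum)
    have "(\<integral>x. sgn (r x - 1) \<partial>P) - (\<integral>x. sgn (r x - 1) \<partial>R) = (\<integral>x. (r x - 1) * sgn (r x - 1) \<partial>R)"
      by (rule diff) (auto simp: sgn_if)
    also have "\<dots> = (\<integral>x. \<bar>r x - 1\<bar> \<partial>R)" by (intro Bochner_Integration.integral_cong) (auto simp: abs_sgn)
    finally have "\<bar>(\<integral>x. sgn (r x - 1) \<partial>P) - (\<integral>x. sgn (r x - 1) \<partial>R)\<bar> = (\<integral>x. \<bar>r x - 1\<bar> \<partial>R)" by simp
    then show "(\<integral>x. \<bar>r x - 1\<bar> \<partial>R) \<in> (\<lambda>f. \<bar>(\<integral>x. f x \<partial>P) - (\<integral>x. f x \<partial>R)\<bar>) ` {f \<in> borel_measurable R. \<forall>x. \<bar>f x\<bar> \<le> 1}"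
      by (intro image_eqI[where x="\<lambda>x. sgn (r x - 1)"]) (auto simp: sgn_if)
  next
    fix y :: real assume "y \<in> (\<lambda>f. \<bar>(\<integral>x. f x \<partial>P) - (\<integral>x. f x \<partial>R)\<bar>) ` {f \<in> borel_measurable R. \<forall>x. \<bar>f x\<bar> \<le> 1}"
    then obtain f :: "'a \<Rightarrow> real" where f[measurable]: "f \<in> borel_measurable R" and f1: "\<And>x. \<bar>f x\<bar> \<le> 1"
      and y: "y = \<bar>(\<integral>x. f x \<partial>P) - (\<integral>x. f x \<partial>R)\<bar>" by auto
    have le: "\<bar>(r x - 1) * f x\<bar> \<le> \<bar>r x - 1\<bar>" for x
      using f1 by (auto simp: abs_mult intro!: mult_left_le)
    have "y = \<bar>\<integral>x. (r x - 1) * f x \<partial>R\<bar>" unfolding y by (simp add: diff f1)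
    also have "\<dots> \<le> (\<integral>x. \<bar>(r x - 1) * f x\<bar> \<partial>R)" by (rule integral_abs_bound)
    also have "\<dots> \<le> (\<integral>x. \<bar>r x - 1\<bar> \<partial>R)"
      using le by (intro integral_mono id Bochner_Integration.integrable_bound[OF id]) auto
    finally show "y \<le> (\<integral>x. \<bar>r x - 1\<bar> \<partial>R)" .
  qed
  then show ?thesis by (simp add: nn_integral_eq_integral[OF id])
qed

text \<open>Finite intersections from a countable basis form a countable intersection-stable
  generator, which determines finite measures. Being fixed before the measures, it lets almost sure
  equalities on single sets be combined into an almost sure equality of random measures.\<close>

lemma measure_eqI_borel_countable:
  obtains C :: "'x::second_countable_topology set set" where "countable C" "C \<subseteq> sets borel"
    "\<forall>M N. sets M = sets borel \<longrightarrow> sets N = sets borel \<longrightarrow> finite_measure M \<longrightarrow>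
      (\<forall>A\<in>C. emeasure M A = emeasure N A) \<longrightarrow> M = N"
proof -
  obtain B :: "'x set set" where B: "countable B" "topological_basis B"
    using ex_countable_basis by blast
  \<comment> \<open>The empty intersection puts \<open>UNIV\<close> into \<open>C\<close>, so
    equality of the total masses is included.\<close>
  define C where "C = Inter ` {F. finite F \<and> F \<subseteq> B}"
  have "countable C" unfolding C_def by (intro countable_image countable_Collect_finite_subset B(1))
  have opn: "open A" if "A \<in> C" for A
    using that topological_basis_open[OF B(2)] unfolding C_def by (auto intro: open_Inter)
  have "Int_stable C"
  proof (rule Int_stableI)
    fix a b assume "a \<in> C" "b \<in> C"
    then obtain F G where "finite F" "F \<subseteq> B" "a = \<Inter>F" "finite G" "G \<subseteq> B" "b = \<Inter>G"
      unfolding C_def by blast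
    then show "a \<inter> b \<in> C" unfolding C_def by (intro image_eqI[where x="F \<union> G"]) auto
  qed
  have BC: "B \<subseteq> C" unfolding C_def by (auto intro!: image_eqI[where x="{_}"])
  have "sigma_sets UNIV B = sets borel" by (subst borel_eq_countable_basis[OF B]) simp
  moreover have "sigma_sets UNIV C \<subseteq> sets borel"
    using opn by (intro sets.sigma_sets_subset[of _ borel, simplified]) auto
  moreover have "sigma_sets UNIV B \<subseteq> sigma_sets UNIV C" using BC by (rule sigma_sets_mono')
  ultimately have sC: "sigma_sets UNIV C = sets borel" by auto
  show thesis
  proof (rule that[OF \<open>countable C\<close>], goal_cases)
    case 1
    show "C \<subseteq> sets borel" using opn by auto
  next
    case 2
    show ?case
    proof (intro allI impI)
    fix M N :: "'x measure"
    assume M: "sets M = sets borel" and N: "sets N = sets borel" and "finite_measure M"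
      and eq: "\<forall>A\<in>C. emeasure M A = emeasure N A"
    interpret finite_measure M by fact
    show "M = N"
      by (rule measure_eqI_generator_eq[OF \<open>Int_stable C\<close>, where \<Omega>=UNIV and A="\<lambda>_. UNIV"])
        (use eq M N sC in \<open>auto simp: C_def\<close>)
    qed
  qed
qed

section \<open>The Markov property of the hidden Markov model\<close>

lemma space_path_space: "space (path_space :: (nat \<Rightarrow> 'x::topological_space \<times> 'y::topological_space) measure) = UNIV"
  by (simp add: path_space_def space_PiM)

lemma space_obs_sigma[simp]: "space (obs_sigma n) = UNIV"
  by (simp add: obs_sigma_def space_path_space)

lemma measurable_obs_sigma:
  assumes "\<And>i. i \<le> n \<Longrightarrow> (\<lambda>x. snd (f x i)) \<in> M \<rightarrow>\<^sub>M borel"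
  shows "f \<in> M \<rightarrow>\<^sub>M (obs_sigma n :: (nat \<Rightarrow> 'x::topological_space \<times> 'y::topological_space) measure)"
  unfolding obs_sigma_def
  by (rule measurable_vimage_algebra2) (auto simp: space_path_space intro!: measurable_restrict assms)

lemma snd_obs_sigma:
  assumes "i \<le> n"
  shows "(\<lambda>\<omega>. snd (\<omega> i)) \<in> (obs_sigma n :: (nat \<Rightarrow> 'x::topological_space \<times> 'y::topological_space) measure) \<rightarrow>\<^sub>M borel"
proof -
  have "(\<lambda>\<omega>. \<lambda>i\<in>{..n}. snd (\<omega> i)) \<in> (obs_sigma n :: (nat \<Rightarrow> 'x \<times> 'y) measure) \<rightarrow>\<^sub>M (\<Pi>\<^sub>M i\<in>{..n}. borel)"
    unfolding obs_sigma_def by (rule measurable_vimage_algebra1) (auto simp: space_PiM)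
  then have "(\<lambda>\<omega>. (\<lambda>i\<in>{..n}. snd (\<omega> i)) i) \<in> (obs_sigma n :: (nat \<Rightarrow> 'x \<times> 'y) measure) \<rightarrow>\<^sub>M borel"
    by (rule measurable_compose[OF _ measurable_component_singleton]) (use assms in auto)
  then show ?thesis using assms by simp
qed

text \<open>The level set of \<open>F (x, _)\<close> through \<open>\<omega>\<close> is a preimage
  under the observation map, hence contains every path with the same observations. This is what
  makes observable functions insensitive to \<open>restrict\<close>.\<close>

lemma obs_sigma_fibre:
  fixes F :: "'a \<times> (nat \<Rightarrow> 'x::topological_space \<times> 'y::topological_space) \<Rightarrow> ennreal"
  assumes F: "F \<in> borel_measurable (M \<Otimes>\<^sub>M obs_sigma n)" and x: "x \<in> space M"
    and eq: "\<And>i. i \<le> n \<Longrightarrow> snd (\<omega> i) = snd (\<omega>' i)"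
  shows "F (x, \<omega>) = F (x, \<omega>')"
proof -
  have "(\<lambda>\<omega>. F (x, \<omega>)) \<in> borel_measurable (obs_sigma n)"
    using measurable_compose[OF measurable_Pair1'[OF x] F] by simp
  then have "(\<lambda>\<omega>. F (x, \<omega>)) -` {F (x, \<omega>)} \<inter> space (obs_sigma n) \<in> sets (obs_sigma n :: (nat \<Rightarrow> 'x \<times> 'y) measure)"
    by (rule measurable_sets) simp
  then obtain B where "(\<lambda>\<omega>. F (x, \<omega>)) -` {F (x, \<omega>)} = (\<lambda>\<omega>. \<lambda>i\<in>{..n}. snd (\<omega> i)) -` B"
    unfolding obs_sigma_def by (subst (asm) sets_vimage_algebra2) (auto simp: space_path_space space_PiM)
  moreover have "(\<lambda>i\<in>{..n}. snd (\<omega> i)) = (\<lambda>i\<in>{..n}. snd (\<omega>' i))"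
    using eq by (auto simp: restrict_def)
  ultimately show ?thesis by (metis (mono_tags, lifting) vimage_singleton_eq vimage_eq)
qed

lemma fst_borel[measurable]: "fst \<in> (borel :: ('x::topological_space \<times> 'y::topological_space) measure) \<rightarrow>\<^sub>M borel"
  by (intro borel_measurable_continuous_onI continuous_intros)

lemma snd_borel[measurable]: "snd \<in> (borel :: ('x::topological_space \<times> 'y::topological_space) measure) \<rightarrow>\<^sub>M borel"
  by (intro borel_measurable_continuous_onI continuous_intros)

lemma subalgebra_obs_sigma:
  "k \<le> n \<Longrightarrow> subalgebra (obs_sigma n) (obs_sigma k :: (nat \<Rightarrow> 'x::topological_space \<times> 'y::topological_space) measure)"
proof -
  assume "k \<le> n"
  then have id: "(\<lambda>\<omega>. \<omega>) \<in> (obs_sigma n :: (nat \<Rightarrow> 'x \<times> 'y) measure) \<rightarrow>\<^sub>M obs_sigma k"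
    by (intro measurable_obs_sigma snd_obs_sigma) auto
  show ?thesis unfolding subalgebra_def using measurable_sets[OF id] by auto
qed

lemma id_path_obs[measurable]:
  "(\<lambda>\<omega>. \<omega>) \<in> (path_space :: (nat \<Rightarrow> 'x::topological_space \<times> 'y::topological_space) measure) \<rightarrow>\<^sub>M obs_sigma n"
  unfolding path_space_def by (intro measurable_obs_sigma) measurable

lemma subalgebra_path_obs:
  "subalgebra (path_space :: (nat \<Rightarrow> 'x::topological_space \<times> 'y::topological_space) measure) (obs_sigma n)"
  unfolding subalgebra_def using measurable_sets[OF id_path_obs] by (auto simp: space_path_space)

lemma state_path[measurable]:
  "(\<lambda>\<omega>. fst (\<omega> n)) \<in> (path_space :: (nat \<Rightarrow> 'x::topological_space \<times> 'y::topological_space) measure) \<rightarrow>\<^sub>M borel"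
  unfolding path_space_def by measurable

lemma obs_kernel_measurable:
  fixes h :: "'x::polish_space \<Rightarrow> 'z::polish_space \<Rightarrow> 'y::polish_space"
  assumes "prob_space Q" "sets Q = sets borel" and h: "case_prod h \<in> borel_measurable (borel \<Otimes>\<^sub>M borel)"
  shows "obs_kernel h Q \<in> borel \<rightarrow>\<^sub>M prob_algebra borel"
proof -
  have "(\<lambda>(x, z). (x, h x z)) \<in> borel \<Otimes>\<^sub>M borel \<rightarrow>\<^sub>M (borel \<Otimes>\<^sub>M borel)"
    using h unfolding split_beta' by measurable
  then have "case_prod (\<lambda>x z. (x, h x z)) \<in> borel \<Otimes>\<^sub>M borel \<rightarrow>\<^sub>M borel" by (simp add: borel_prod)
  moreover have "(\<lambda>_. Q) \<in> borel \<rightarrow>\<^sub>M prob_algebra borel"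
    using assms by (intro measurable_const) (simp add: space_prob_algebra)
  ultimately show ?thesis unfolding obs_kernel_def by (rule measurable_distr_prob_space2[rotated])
qed

section \<open>Transition mechanism and integrals of adapted functions\<close>

locale hmm =
  fixes T :: "'x::polish_space \<Rightarrow> 'x measure" and Q :: "'z::polish_space measure"
    and h :: "'x \<Rightarrow> 'z \<Rightarrow> 'y::polish_space"
  assumes T: "T \<in> borel \<rightarrow>\<^sub>M prob_algebra borel"
    and Q: "prob_space Q" "sets Q = sets borel"
    and h: "case_prod h \<in> borel_measurable (borel \<Otimes>\<^sub>M borel)"
begin

definition emit where "emit = obs_kernel h Q"
definition step where "step x = bind (T x) emit"

lemma emit[measurable]: "emit \<in> borel \<rightarrow>\<^sub>M prob_algebra borel"
  unfolding emit_def by (rule obs_kernel_measurable[OF Q h])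

lemma step[measurable]: "step \<in> borel \<rightarrow>\<^sub>M prob_algebra borel"
  unfolding step_def using T by measurable

lemmas step_subprob[measurable] = measurable_prob_algebraD[OF step]
lemmas emit_subprob[measurable] = measurable_prob_algebraD[OF emit]

lemma sets_step: "sets (step x) = sets borel"
  using measurable_space[OF step, of x] by (simp add: space_prob_algebra)

text \<open>\<open>hmm_fdd\<close> lives on extensional functions on \<open>{..n}\<close> while the observation \<open>\<sigma>\<close>-fields live on full paths;
  invariance under \<open>restrict\<close> lets the same function be integrated on both.\<close>
definition adapted :: "nat \<Rightarrow> ((nat \<Rightarrow> 'x \<times> 'y) \<Rightarrow> ennreal) \<Rightarrow> bool" where
  "adapted n G \<longleftrightarrow> G \<in> borel_measurable (\<Pi>\<^sub>M i\<in>{..n}. borel) \<and> (\<forall>\<omega>. G (restrict \<omega> {..n}) = G \<omega>)"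

lemma adapted_mono:
  assumes G: "adapted k G" and "k \<le> n"
  shows "adapted n G"
proof -
  have "G \<in> borel_measurable (\<Pi>\<^sub>M i\<in>{..k}. borel)" using G by (simp add: adapted_def)
  then have "(\<lambda>\<omega>. G (restrict \<omega> {..k})) \<in> borel_measurable (\<Pi>\<^sub>M i\<in>{..n}. borel)"
    by (rule measurable_compose[rotated]) (intro measurable_restrict_subset, use assms(2) in auto)
  moreover have "G (restrict \<omega> {..n}) = G \<omega>" for \<omega>
  proof -
    have "G (restrict \<omega> {..n}) = G (restrict (restrict \<omega> {..n}) {..k})" using G by (simp only: adapted_def)
    also have "restrict (restrict \<omega> {..n}) {..k} = restrict \<omega> {..k}"
      using assms(2) by (auto simp: restrict_def)
    finally show ?thesis using G by (simp only: adapted_def)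
  qed
  ultimately show ?thesis using G by (simp add: adapted_def)
qed

lemma adapted_times: "adapted n G \<Longrightarrow> adapted n G' \<Longrightarrow> adapted n (\<lambda>\<omega>. G \<omega> * G' \<omega>)"
  unfolding adapted_def by auto

lemma adapted_fun_upd: "adapted n G \<Longrightarrow> G (fun_upd \<omega> (Suc n) s) = G \<omega>"
proof -
  assume G: "adapted n G"
  then have "G (fun_upd \<omega> (Suc n) s) = G (restrict (fun_upd \<omega> (Suc n) s) {..n})" by (simp only: adapted_def)
  also have "restrict (fun_upd \<omega> (Suc n) s) {..n} = restrict \<omega> {..n}" by (auto simp: restrict_def)
  finally show ?thesis using G by (simp only: adapted_def)
qed

lemma adapted_state_obs:
  fixes F :: "'x \<times> (nat \<Rightarrow> 'x \<times> 'y) \<Rightarrow> ennreal"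
  assumes F: "F \<in> borel_measurable (borel \<Otimes>\<^sub>M obs_sigma n)"
  shows "adapted n (\<lambda>\<omega>. F (fst (\<omega> n), \<omega>))"
proof -
  have "(\<lambda>\<omega>. (fst (\<omega> n), \<omega>)) \<in> (\<Pi>\<^sub>M i\<in>{..n}. (borel :: ('x \<times> 'y) measure)) \<rightarrow>\<^sub>M borel \<Otimes>\<^sub>M obs_sigma n"
    by (intro measurable_Pair measurable_obs_sigma) (auto intro!: measurable_compose[OF measurable_component_singleton])
  moreover have "F (x, restrict \<omega> {..n}) = F (x, \<omega>)" for x \<omega>
    by (rule obs_sigma_fibre[OF F]) auto
  ultimately show ?thesis unfolding adapted_def using F by (auto intro: measurable_compose)
qed

text \<open>The bridge from the path law, known only through its finite-dimensional marginals, to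
  the recursion \<open>hmm_fdd\<close>.\<close>

lemma law_integral:
  assumes P: "hmm_law T Q h \<mu> P" and G: "adapted n G"
  shows "(\<integral>\<^sup>+ \<omega>. G \<omega> \<partial>P) = (\<integral>\<^sup>+ \<omega>. G \<omega> \<partial>(hmm_fdd T Q h \<mu> n))"
proof -
  have S: "sets P = sets path_space" using P by (simp add: hmm_law_def)
  have m: "(\<lambda>\<omega>. restrict \<omega> {..n}) \<in> P \<rightarrow>\<^sub>M (\<Pi>\<^sub>M i\<in>{..n}. borel)"
    unfolding measurable_cong_sets[OF S refl] path_space_def
    by (intro measurable_restrict_subset) auto
  have "(\<integral>\<^sup>+ \<omega>. G \<omega> \<partial>P) = (\<integral>\<^sup>+ \<omega>. G (restrict \<omega> {..n}) \<partial>P)" using G by (simp add: adapted_def)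
  also have "\<dots> = (\<integral>\<^sup>+ \<omega>. G \<omega> \<partial>(distr P (\<Pi>\<^sub>M i\<in>{..n}. borel) (\<lambda>\<omega>. restrict \<omega> {..n})))"
    using G unfolding adapted_def by (intro nn_integral_distr[symmetric, OF m]) simp
  finally show ?thesis using P by (simp add: hmm_law_def)
qed

lemma sets_fdd: "hmm_law T Q h \<mu> P \<Longrightarrow> sets (hmm_fdd T Q h \<mu> n) = sets (\<Pi>\<^sub>M i\<in>{..n}. borel)"
  by (metis hmm_law_def sets_distr)

text \<open>The last coordinate is integrated out with the kernel \<open>step\<close>. The outcome
  \<open>F'\<close> needs only the current state and the observations, and it is chosen before
  \<open>\<mu>\<close> and \<open>P\<close>, so one function serves both laws. The weight
  \<open>U\<close> may depend on the whole past, including hidden states.\<close>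

lemma markov_step:
  assumes F: "F \<in> borel_measurable (borel \<Otimes>\<^sub>M (obs_sigma (Suc n) :: (nat \<Rightarrow> 'x \<times> 'y) measure))"
  obtains F' where "F' \<in> borel_measurable (borel \<Otimes>\<^sub>M (obs_sigma n :: (nat \<Rightarrow> 'x \<times> 'y) measure))"
    "\<And>\<mu> P U. hmm_law T Q h \<mu> P \<Longrightarrow> adapted n U \<Longrightarrow>
      (\<integral>\<^sup>+ \<omega>. U \<omega> * F (fst (\<omega> (Suc n)), \<omega>) \<partial>P) = (\<integral>\<^sup>+ \<omega>. U \<omega> * F' (fst (\<omega> n), \<omega>) \<partial>P)"
proof -
  define F' where "F' p = (\<integral>\<^sup>+ s. F (fst s, fun_upd (snd p) (Suc n) s) \<partial>(step (fst p)))" for p :: "'x \<times> (nat \<Rightarrow> 'x \<times> 'y)"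
  let ?S = "(borel :: 'x measure) \<Otimes>\<^sub>M (obs_sigma n :: (nat \<Rightarrow> 'x \<times> 'y) measure)"
  \<comment> \<open>The observations of the extended path are those of the old path up to
    \<open>n\<close> and the one of the new pair at \<open>Suc n\<close>; hidden states of the old
    path do not enter.\<close>
  have upd: "(\<lambda>p. fun_upd (snd (fst p)) (Suc n) (snd p)) \<in> ?S \<Otimes>\<^sub>M borel \<rightarrow>\<^sub>M obs_sigma (Suc n)"
  proof (rule measurable_obs_sigma)
    fix i assume "i \<le> Suc n"
    then consider "i \<le> n" | "i = Suc n" by linarith
    then show "(\<lambda>p. snd ((fun_upd (snd (fst p)) (Suc n) (snd p)) i)) \<in> ?S \<Otimes>\<^sub>M borel \<rightarrow>\<^sub>M borel"
    proof cases
      case 1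
      have "(\<lambda>p. snd ((snd (fst p)) i)) \<in> ?S \<Otimes>\<^sub>M (borel :: ('x \<times> 'y) measure) \<rightarrow>\<^sub>M borel"
        by (rule measurable_compose[OF _ snd_obs_sigma[OF 1]]) measurable
      then show ?thesis using 1 by simp
    qed simp
  qed
  have F': "F' \<in> borel_measurable (borel \<Otimes>\<^sub>M obs_sigma n)"
    unfolding F'_def
  proof (rule nn_integral_measurable_subprob_algebra2)
    show "(\<lambda>(p, s). F (fst s, fun_upd (snd p) (Suc n) s)) \<in> borel_measurable (?S \<Otimes>\<^sub>M borel)"
      unfolding split_beta'
      by (rule measurable_compose[OF _ F], intro measurable_Pair upd) measurable
    show "(\<lambda>p. step (fst p)) \<in> ?S \<rightarrow>\<^sub>M subprob_algebra borel"
      by (rule measurable_compose[OF measurable_fst step_subprob])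
  qed
  show thesis
  proof (rule that[OF F'])
    fix \<mu> P and U :: "(nat \<Rightarrow> 'x \<times> 'y) \<Rightarrow> ennreal"
    assume P: "hmm_law T Q h \<mu> P" and U: "adapted n U"
    let ?M = "hmm_fdd T Q h \<mu> n"
    let ?\<kappa> = "\<lambda>\<omega>. distr (step (fst (\<omega> n))) (\<Pi>\<^sub>M i\<in>{..Suc n}. borel) (\<lambda>s. fun_upd \<omega> (Suc n) s)"
    let ?G = "\<lambda>\<omega>. U \<omega> * F (fst (\<omega> (Suc n)), \<omega>)"
    let ?G' = "\<lambda>\<omega>. U \<omega> * F' (fst (\<omega> n), \<omega>)"
    have aG: "adapted (Suc n) ?G"
      by (intro adapted_times adapted_state_obs F adapted_mono[OF U]) simp
    have aG': "adapted n ?G'"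
      by (intro adapted_times adapted_state_obs F' U)
    have G: "?G \<in> borel_measurable (\<Pi>\<^sub>M i\<in>{..Suc n}. borel)" using aG by (simp add: adapted_def)
    have \<kappa>: "?\<kappa> \<in> (\<Pi>\<^sub>M i\<in>{..n}. borel) \<rightarrow>\<^sub>M subprob_algebra (\<Pi>\<^sub>M i\<in>{..Suc n}. borel)"
    proof (rule measurable_distr2)
      show "(\<lambda>(\<omega>, s). fun_upd \<omega> (Suc n) s) \<in> (\<Pi>\<^sub>M i\<in>{..n}. borel) \<Otimes>\<^sub>M borel \<rightarrow>\<^sub>M (\<Pi>\<^sub>M i\<in>{..Suc n}. borel)"
        unfolding atMost_Suc by (rule measurable_add_dim)
      show "(\<lambda>\<omega>. step (fst (\<omega> n))) \<in> (\<Pi>\<^sub>M i\<in>{..n}. (borel :: ('x \<times> 'y) measure)) \<rightarrow>\<^sub>M subprob_algebra borel"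
        by (intro measurable_compose[OF _ step_subprob] measurable_compose[OF measurable_component_singleton]) auto
    qed
    have "(\<integral>\<^sup>+ \<omega>. ?G \<omega> \<partial>P) = (\<integral>\<^sup>+ \<omega>. ?G \<omega> \<partial>(hmm_fdd T Q h \<mu> (Suc n)))"
      by (rule law_integral[OF P aG])
    also have "\<dots> = (\<integral>\<^sup>+ \<omega>. (\<integral>\<^sup>+ \<omega>'. ?G \<omega>' \<partial>(?\<kappa> \<omega>)) \<partial>?M)"
      unfolding hmm_fdd.simps emit_def[symmetric] step_def[symmetric]
      by (rule nn_integral_bind[OF G]) (use \<kappa> in \<open>simp add: measurable_cong_sets[OF sets_fdd[OF P] refl]\<close>)
    also have "\<dots> = (\<integral>\<^sup>+ \<omega>. ?G' \<omega> \<partial>?M)"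
    proof (rule nn_integral_cong)
      fix \<omega> assume "\<omega> \<in> space ?M"
      then have w: "\<omega> \<in> space (\<Pi>\<^sub>M i\<in>{..n}. (borel :: ('x \<times> 'y) measure))"
        using sets_eq_imp_space_eq[OF sets_fdd[OF P]] by auto
      have "(\<lambda>s. fun_upd \<omega> (Suc n) s) \<in> borel \<rightarrow>\<^sub>M (\<Pi>\<^sub>M i\<in>{..Suc n}. (borel :: ('x \<times> 'y) measure))"
        unfolding atMost_Suc using measurable_compose[OF measurable_Pair1'[OF w] measurable_add_dim] by simp
      then have m: "(\<lambda>s. fun_upd \<omega> (Suc n) s) \<in> step x \<rightarrow>\<^sub>M (\<Pi>\<^sub>M i\<in>{..Suc n}. (borel :: ('x \<times> 'y) measure))" for x
        by (simp add: measurable_cong_sets[OF sets_step refl])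
      have "(\<integral>\<^sup>+ \<omega>'. ?G \<omega>' \<partial>(?\<kappa> \<omega>)) = (\<integral>\<^sup>+ s. ?G (fun_upd \<omega> (Suc n) s) \<partial>(step (fst (\<omega> n))))"
        by (rule nn_integral_distr[OF m]) (simp add: G)
      \<comment> \<open>\<open>U\<close> does not see coordinate \<open>Suc n\<close>, so it is
        constant under the update and factors out.\<close>
      also have "\<dots> = (\<integral>\<^sup>+ s. U \<omega> * F (fst s, fun_upd \<omega> (Suc n) s) \<partial>(step (fst (\<omega> n))))"
        by (simp add: adapted_fun_upd[OF U])
      also have "\<dots> = ?G' \<omega>"
        unfolding F'_def fst_conv snd_conv
      proof (rule nn_integral_cmult)
        have "(\<lambda>s. (fst s, fun_upd \<omega> (Suc n) s)) \<in> (borel :: ('x \<times> 'y) measure) \<rightarrow>\<^sub>M borel \<Otimes>\<^sub>M obs_sigma (Suc n)"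
          by (intro measurable_Pair measurable_obs_sigma fst_borel) (auto simp: le_Suc_eq)
        from measurable_compose[OF this F]
        show "(\<lambda>s. F (fst s, fun_upd \<omega> (Suc n) s)) \<in> borel_measurable (step (fst (\<omega> n)))"
          by (simp add: measurable_cong_sets[OF sets_step refl])
      qed
      finally show "(\<integral>\<^sup>+ \<omega>'. ?G \<omega>' \<partial>(?\<kappa> \<omega>)) = ?G' \<omega>" .
    qed
    also have "\<dots> = (\<integral>\<^sup>+ \<omega>. ?G' \<omega> \<partial>P)"
      by (rule law_integral[OF P aG', symmetric])
    finally show "(\<integral>\<^sup>+ \<omega>. ?G \<omega> \<partial>P) = (\<integral>\<^sup>+ \<omega>. ?G' \<omega> \<partial>P)" .
  qed
qed

text \<open>Iterates \<open>markov_step\<close> from \<open>n\<close> down to \<open>k\<close>; a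
  weight adapted at time \<open>k\<close> stays adapted at every intermediate time. The function
  \<open>F'\<close> still precedes the choice of law.\<close>

lemma markov_steps:
  assumes kn: "k \<le> n" and F: "F \<in> borel_measurable (borel \<Otimes>\<^sub>M (obs_sigma n :: (nat \<Rightarrow> 'x \<times> 'y) measure))"
  shows "\<exists>F' \<in> borel_measurable (borel \<Otimes>\<^sub>M (obs_sigma k :: (nat \<Rightarrow> 'x \<times> 'y) measure)).
    \<forall>\<mu> P U. hmm_law T Q h \<mu> P \<longrightarrow> adapted k U \<longrightarrow>
      (\<integral>\<^sup>+ \<omega>. U \<omega> * F (fst (\<omega> n), \<omega>) \<partial>P) = (\<integral>\<^sup>+ \<omega>. U \<omega> * F' (fst (\<omega> k), \<omega>) \<partial>P)"
  using kn F
proof (induction n arbitrary: F rule: dec_induct)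
  case base
  then show ?case by blast
next
  case (step n)
  obtain F1 where F1: "F1 \<in> borel_measurable (borel \<Otimes>\<^sub>M (obs_sigma n :: (nat \<Rightarrow> 'x \<times> 'y) measure))"
    "\<And>\<mu> P U. hmm_law T Q h \<mu> P \<Longrightarrow> adapted n U \<Longrightarrow>
      (\<integral>\<^sup>+ \<omega>. U \<omega> * F (fst (\<omega> (Suc n)), \<omega>) \<partial>P) = (\<integral>\<^sup>+ \<omega>. U \<omega> * F1 (fst (\<omega> n), \<omega>) \<partial>P)"
    by (rule markov_step[OF step.prems]) (rule that)
  obtain F2 where F2: "F2 \<in> borel_measurable (borel \<Otimes>\<^sub>M (obs_sigma k :: (nat \<Rightarrow> 'x \<times> 'y) measure))"
    "\<forall>\<mu> P U. hmm_law T Q h \<mu> P \<longrightarrow> adapted k U \<longrightarrow>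
      (\<integral>\<^sup>+ \<omega>. U \<omega> * F1 (fst (\<omega> n), \<omega>) \<partial>P) = (\<integral>\<^sup>+ \<omega>. U \<omega> * F2 (fst (\<omega> k), \<omega>) \<partial>P)"
    using step.IH[OF F1(1)] by (elim bexE)
  show ?case
  proof (intro bexI[OF _ F2(1)] allI impI)
    fix \<mu> P U assume P: "hmm_law T Q h \<mu> P" and U: "adapted k U"
    show "(\<integral>\<^sup>+ \<omega>. U \<omega> * F (fst (\<omega> (Suc n)), \<omega>) \<partial>P) = (\<integral>\<^sup>+ \<omega>. U \<omega> * F2 (fst (\<omega> k), \<omega>) \<partial>P)"
      using F1(2)[OF P adapted_mono[OF U step.hyps(1)]] F2(2)[rule_format, OF P U] by simp
  qed
qed

text \<open>Together with \<open>markov_steps\<close> this reduces the expectation of any function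
  of the current state and the observations to the integral of one fixed function against the
  initial law.\<close>

lemma initial_step:
  assumes F: "F \<in> borel_measurable (borel \<Otimes>\<^sub>M (obs_sigma 0 :: (nat \<Rightarrow> 'x \<times> 'y) measure))"
  shows "\<exists>F' \<in> borel_measurable borel.
    \<forall>\<mu> P. sets \<mu> = sets borel \<longrightarrow> hmm_law T Q h \<mu> P \<longrightarrow>
      (\<integral>\<^sup>+ \<omega>. F (fst (\<omega> 0), \<omega>) \<partial>P) = (\<integral>\<^sup>+ x. F' x \<partial>\<mu>)"
proof (intro bexI allI impI)
  let ?G = "\<lambda>\<omega>. F (fst (\<omega> 0), \<omega>)"
  let ?c = "\<lambda>s. \<lambda>i\<in>{..0::nat}. s"
  have aG: "adapted 0 ?G" by (rule adapted_state_obs[OF F])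
  have c: "?c \<in> borel \<rightarrow>\<^sub>M (\<Pi>\<^sub>M i\<in>{..0}. (borel :: ('x \<times> 'y) measure))"
    by (intro measurable_restrict) simp
  have G: "?G \<in> borel_measurable (\<Pi>\<^sub>M i\<in>{..0}. borel)" using aG by (simp add: adapted_def)
  have Gc: "(\<lambda>s. ?G (?c s)) \<in> borel_measurable borel" by (rule measurable_compose[OF c G])
  show "(\<lambda>x. \<integral>\<^sup>+ s. ?G (?c s) \<partial>(emit x)) \<in> borel_measurable borel"
    by (rule nn_integral_measurable_subprob_algebra2[OF _ emit_subprob])
      (unfold split_beta', rule measurable_compose[OF measurable_snd Gc])
  fix \<mu> P assume \<mu>: "sets \<mu> = sets borel" and P: "hmm_law T Q h \<mu> P"
  have em: "emit \<in> \<mu> \<rightarrow>\<^sub>M subprob_algebra borel" by (simp add: measurable_cong_sets[OF \<mu> refl] emit_subprob)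
  have "(\<integral>\<^sup>+ \<omega>. ?G \<omega> \<partial>P) = (\<integral>\<^sup>+ \<omega>. ?G \<omega> \<partial>(distr (bind \<mu> emit) (\<Pi>\<^sub>M i\<in>{..0::nat}. borel) ?c))"
    using law_integral[OF P aG] by (simp add: emit_def)
  also have "\<dots> = (\<integral>\<^sup>+ s. ?G (?c s) \<partial>(bind \<mu> emit))"
  proof (rule nn_integral_distr)
    show "?G \<in> borel_measurable (distr (bind \<mu> emit) (\<Pi>\<^sub>M i\<in>{..0::nat}. borel) ?c)"
      using G by (simp only: measurable_distr_eq1)
    have "space \<mu> \<noteq> {}" using sets_eq_imp_space_eq[OF \<mu>] by simp
    then have sb: "sets (bind \<mu> emit) = sets borel"
      using measurable_space[OF em] by (intro sets_bind) (auto simp: space_subprob_algebra)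
    show "?c \<in> bind \<mu> emit \<rightarrow>\<^sub>M (\<Pi>\<^sub>M i\<in>{..0}. borel)"
      unfolding measurable_cong_sets[OF sb refl] by (rule c)
  qed
  also have "\<dots> = (\<integral>\<^sup>+ x. \<integral>\<^sup>+ s. ?G (?c s) \<partial>(emit x) \<partial>\<mu>)"
    by (rule nn_integral_bind[OF Gc em])
  finally show "(\<integral>\<^sup>+ \<omega>. ?G \<omega> \<partial>P) = (\<integral>\<^sup>+ x. \<integral>\<^sup>+ s. ?G (?c s) \<partial>(emit x) \<partial>\<mu>)" .
qed

end

section \<open>Filters as disintegrations\<close>

context
  fixes P :: "(nat \<Rightarrow> 'x::polish_space \<times> 'y::polish_space) measure" and n :: nat
    and \<pi> :: "(nat \<Rightarrow> 'x \<times> 'y) \<Rightarrow> 'x measure"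
  assumes P: "prob_space P" "sets P = sets path_space"
    and \<pi>: "hmm_filter P n \<pi>"
begin

lemma filter_space: "space P = UNIV"
  using sets_eq_imp_space_eq[OF P(2)] by (simp add: space_path_space)

lemma filter_kernel: "\<pi> \<in> obs_sigma n \<rightarrow>\<^sub>M prob_algebra borel"
proof (rule measurable_prob_algebraI)
  show "prob_space (\<pi> \<omega>)" for \<omega> using \<pi> by (simp add: hmm_filter_def filter_space)
  then have ps: "prob_space (\<pi> \<omega>)" for \<omega> .
  show "\<pi> \<in> obs_sigma n \<rightarrow>\<^sub>M subprob_algebra borel"
  proof (rule measurable_subprob_algebra)
    show "subprob_space (\<pi> \<omega>)" for \<omega> using ps by (rule prob_space_imp_subprob_space)
    show "sets (\<pi> \<omega>) = sets borel" for \<omega> using \<pi> by (simp add: hmm_filter_def filter_space)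
    fix A :: "'x set" assume "A \<in> sets borel"
    then have "(\<lambda>\<omega>. measure (\<pi> \<omega>) A) \<in> borel_measurable (obs_sigma n)" using \<pi> by (simp add: hmm_filter_def)
    then have "(\<lambda>\<omega>. ennreal (measure (\<pi> \<omega>) A)) \<in> borel_measurable (obs_sigma n)" by (rule measurable_compose) simp
    moreover have "emeasure (\<pi> \<omega>) A = ennreal (measure (\<pi> \<omega>) A)" for \<omega>
    proof -
      interpret prob_space "\<pi> \<omega>" by (rule ps)
      show ?thesis by (rule emeasure_eq_measure)
    qed
    ultimately show "(\<lambda>\<omega>. emeasure (\<pi> \<omega>) A) \<in> borel_measurable (obs_sigma n)" by simp
  qed
qed

lemma filter_prob: "prob_space (\<pi> \<omega>)" and filter_sets: "sets (\<pi> \<omega>) = sets borel"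
  using measurable_space[OF filter_kernel, of \<omega>] by (simp_all add: space_prob_algebra)

lemma obs_P_measurable: "(\<lambda>\<omega>. \<omega>) \<in> P \<rightarrow>\<^sub>M obs_sigma k"
  using id_path_obs by (simp only: measurable_cong_sets[OF P(2) refl])

lemma state_P_measurable: "(\<lambda>\<omega>. fst (\<omega> k)) \<in> P \<rightarrow>\<^sub>M borel"
  using state_path by (simp only: measurable_cong_sets[OF P(2) refl])

text \<open>The identity in \<open>hmm_filter\<close> concerns Bochner integrals of real
  probabilities; their bound by one carries it over to nonnegative integrals.\<close>

lemma filter_rectangle:
  assumes A: "A \<in> sets borel" and B: "B \<in> sets (obs_sigma n)"
  shows "emeasure P {\<omega>. fst (\<omega> n) \<in> A \<and> \<omega> \<in> B} = (\<integral>\<^sup>+ \<omega>. emeasure (\<pi> \<omega>) A * indicator B \<omega> \<partial>P)"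
proof -
  interpret prob_space P by (rule P)
  have Bm: "B \<in> sets P" using measurable_sets[OF obs_P_measurable B] by (simp add: filter_space)
  have mA: "(\<lambda>\<omega>. measure (\<pi> \<omega>) A) \<in> borel_measurable P"
    using \<pi> A by (intro measurable_compose[OF obs_P_measurable[of n]]) (simp add: hmm_filter_def)
  have m1: "0 \<le> measure (\<pi> \<omega>) A \<and> measure (\<pi> \<omega>) A \<le> 1" for \<omega>
  proof -
    interpret pi: prob_space "\<pi> \<omega>" by (rule filter_prob)
    show ?thesis by simp
  qed
  have "ennreal (\<integral>\<omega>. indicator B \<omega> * measure (\<pi> \<omega>) A \<partial>P) = (\<integral>\<^sup>+\<omega>. ennreal (indicator B \<omega> * measure (\<pi> \<omega>) A) \<partial>P)"
    using Bm mA m1 by (intro nn_integral_eq_integral[symmetric] integrable_const_bound[where B=1])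
      (auto simp: indicator_def)
  also have "\<dots> = (\<integral>\<^sup>+ \<omega>. emeasure (\<pi> \<omega>) A * indicator B \<omega> \<partial>P)"
  proof (rule nn_integral_cong)
    fix \<omega>
    interpret pi: prob_space "\<pi> \<omega>" by (rule filter_prob)
    show "ennreal (indicator B \<omega> * measure (\<pi> \<omega>) A) = emeasure (\<pi> \<omega>) A * indicator B \<omega>"
      by (auto simp: indicator_def pi.emeasure_eq_measure)
  qed
  finally have "(\<integral>\<^sup>+ \<omega>. emeasure (\<pi> \<omega>) A * indicator B \<omega> \<partial>P) = ennreal (measure P (B \<inter> {\<omega> \<in> space P. fst (\<omega> n) \<in> A}))"
    using \<pi> A B by (simp add: hmm_filter_def)
  also have "B \<inter> {\<omega> \<in> space P. fst (\<omega> n) \<in> A} = {\<omega>. fst (\<omega> n) \<in> A \<and> \<omega> \<in> B}" by (auto simp: filter_space)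
  finally show ?thesis by (simp add: emeasure_eq_measure)
qed

text \<open>Disintegration of the joint law of state and observations. The pushforward and the
  mixture of the kernels \<open>?\<kappa>\<close>, each the product of the filter with a point mass
  at the path, agree on rectangles by \<open>filter_rectangle\<close>, and rectangles form an
  intersection-stable generator.\<close>

lemma filter_integral:
  assumes F: "F \<in> borel_measurable (borel \<Otimes>\<^sub>M obs_sigma n)"
  shows "(\<integral>\<^sup>+ \<omega>. F (fst (\<omega> n), \<omega>) \<partial>P) = (\<integral>\<^sup>+ \<omega>. \<integral>\<^sup>+ x. F (x, \<omega>) \<partial>\<pi> \<omega> \<partial>P)"
proof -
  interpret prob_space P by (rule P)
  let ?S = "(borel :: 'x measure) \<Otimes>\<^sub>M (obs_sigma n :: (nat \<Rightarrow> 'x \<times> 'y) measure)"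
  let ?\<kappa> = "\<lambda>\<omega>. distr (\<pi> \<omega>) ?S (\<lambda>x. (x, \<omega>))"
  have pm: "(\<lambda>\<omega>. (fst (\<omega> n), \<omega>)) \<in> P \<rightarrow>\<^sub>M ?S" by (intro measurable_Pair state_P_measurable obs_P_measurable)
  have xm: "(\<lambda>x. (x, \<omega>)) \<in> \<pi> \<omega> \<rightarrow>\<^sub>M ?S" for \<omega>
    unfolding measurable_cong_sets[OF filter_sets refl] by (rule measurable_Pair2') simp
  have "?\<kappa> \<in> obs_sigma n \<rightarrow>\<^sub>M subprob_algebra ?S"
    by (rule measurable_distr2[OF _ measurable_prob_algebraD[OF filter_kernel]]) measurable
  then have \<kappa>: "?\<kappa> \<in> P \<rightarrow>\<^sub>M subprob_algebra ?S" by (rule measurable_compose[OF obs_P_measurable])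
  have "distr P ?S (\<lambda>\<omega>. (fst (\<omega> n), \<omega>)) = bind P ?\<kappa>" (is "?M1 = ?M2")
  proof (rule measure_eqI_generator_eq[where A="\<lambda>_. UNIV" and \<Omega>=UNIV])
    let ?E = "{A \<times> B |A B. A \<in> sets (borel :: 'x measure) \<and> B \<in> sets (obs_sigma n :: (nat \<Rightarrow> 'x \<times> 'y) measure)}"
    show "Int_stable ?E" by (rule Int_stable_pair_measure_generator)
    show "sets ?M1 = sigma_sets UNIV ?E" by (simp add: sets_pair_measure)
    have "sets ?M2 = sets ?S"
      using measurable_space[OF \<kappa>] by (intro sets_bind) (auto simp: space_subprob_algebra filter_space)
    then show "sets ?M2 = sigma_sets UNIV ?E" by (simp add: sets_pair_measure)
    show "range (\<lambda>_. UNIV) \<subseteq> ?E"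
      using sets.top[of "obs_sigma n :: (nat \<Rightarrow> 'x \<times> 'y) measure"] by (auto intro!: exI[of _ UNIV])
    show "emeasure ?M1 UNIV \<noteq> \<infinity>"
      using prob_space.emeasure_space_1[OF prob_space_distr[OF pm]] by (simp add: space_pair_measure)
    fix X assume "X \<in> ?E"
    then obtain A B where X: "X = A \<times> B" and A: "A \<in> sets borel" and B: "B \<in> sets (obs_sigma n)" by blast
    have "emeasure ?M1 X = emeasure P ((\<lambda>\<omega>. (fst (\<omega> n), \<omega>)) -` X \<inter> space P)"
      using A B by (intro emeasure_distr pm) (auto simp: X)
    also have "(\<lambda>\<omega>. (fst (\<omega> n), \<omega>)) -` X \<inter> space P = {\<omega>. fst (\<omega> n) \<in> A \<and> \<omega> \<in> B}" by (auto simp: X filter_space)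
    also have "emeasure P \<dots> = (\<integral>\<^sup>+ \<omega>. emeasure (\<pi> \<omega>) A * indicator B \<omega> \<partial>P)" by (rule filter_rectangle[OF A B])
    also have "\<dots> = (\<integral>\<^sup>+ \<omega>. emeasure (?\<kappa> \<omega>) X \<partial>P)"
    proof (rule nn_integral_cong)
      fix \<omega>
      have "emeasure (?\<kappa> \<omega>) X = emeasure (\<pi> \<omega>) ((\<lambda>x. (x, \<omega>)) -` X \<inter> space (\<pi> \<omega>))"
        using A B by (intro emeasure_distr xm) (auto simp: X)
      also have "(\<lambda>x. (x, \<omega>)) -` X \<inter> space (\<pi> \<omega>) = (if \<omega> \<in> B then A else {})"
        using sets_eq_imp_space_eq[OF filter_sets[of \<omega>]] by (auto simp: X)
      finally show "emeasure (\<pi> \<omega>) A * indicator B \<omega> = emeasure (?\<kappa> \<omega>) X" by (simp add: indicator_def)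
    qed
    also have "\<dots> = emeasure ?M2 X"
      using A B by (intro emeasure_bind[symmetric, OF _ \<kappa>]) (auto simp: X filter_space)
    finally show "emeasure ?M1 X = emeasure ?M2 X" .
  qed auto
  then have "(\<integral>\<^sup>+ p. F p \<partial>?M1) = (\<integral>\<^sup>+ p. F p \<partial>?M2)" by simp
  also have "(\<integral>\<^sup>+ p. F p \<partial>?M2) = (\<integral>\<^sup>+ \<omega>. \<integral>\<^sup>+ p. F p \<partial>?\<kappa> \<omega> \<partial>P)" by (rule nn_integral_bind[OF F \<kappa>])
  also have "\<dots> = (\<integral>\<^sup>+ \<omega>. \<integral>\<^sup>+ x. F (x, \<omega>) \<partial>\<pi> \<omega> \<partial>P)"
    by (intro nn_integral_cong nn_integral_distr xm) (use F in \<open>simp only: measurable_distr_eq1\<close>)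
  also have "(\<integral>\<^sup>+ p. F p \<partial>?M1) = (\<integral>\<^sup>+ \<omega>. F (fst (\<omega> n), \<omega>) \<partial>P)"
    by (intro nn_integral_distr pm) (use F in \<open>simp only: measurable_distr_eq1\<close>)
  finally show ?thesis .
qed

end

section \<open>Filter densities\<close>

context hmm
begin

lemma law_prob: "hmm_law T Q h \<mu> P \<Longrightarrow> prob_space P"
  and law_sets: "hmm_law T Q h \<mu> P \<Longrightarrow> sets P = sets path_space"
  by (simp_all add: hmm_law_def)

lemma state_obs_P_measurable:
  assumes "hmm_law T Q h \<mu> P"
  shows "(\<lambda>\<omega>. (fst (\<omega> n), \<omega>)) \<in> P \<rightarrow>\<^sub>M borel \<Otimes>\<^sub>M obs_sigma n"
  unfolding measurable_cong_sets[OF law_sets[OF assms] refl]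
  by (intro measurable_Pair state_path id_path_obs)

text \<open>Both expectations are integrals of the same function \<open>F2\<close> against the
  initial laws. Vanishing under \<open>\<nu>\<close> forces \<open>F2 = 0\<close> almost everywhere,
  and this passes to \<open>\<mu>\<close> by absolute continuity.\<close>

lemma law_null_sets:
  assumes sets: "sets \<mu> = sets borel" "sets \<nu> = sets borel" and ac: "absolutely_continuous \<nu> \<mu>"
    and P\<mu>: "hmm_law T Q h \<mu> P\<mu>" and P\<nu>: "hmm_law T Q h \<nu> P\<nu>"
    and F: "F \<in> borel_measurable (borel \<Otimes>\<^sub>M obs_sigma n)"
    and null: "(\<integral>\<^sup>+ \<omega>. F (fst (\<omega> n), \<omega>) \<partial>P\<nu>) = 0"
  shows "(\<integral>\<^sup>+ \<omega>. F (fst (\<omega> n), \<omega>) \<partial>P\<mu>) = 0"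
proof -
  have one: "adapted 0 (\<lambda>_. 1)" by (simp add: adapted_def)
  obtain F1 where F1: "F1 \<in> borel_measurable (borel \<Otimes>\<^sub>M (obs_sigma 0 :: (nat \<Rightarrow> 'x \<times> 'y) measure))"
    and F1': "\<forall>\<mu> P U. hmm_law T Q h \<mu> P \<longrightarrow> adapted 0 U \<longrightarrow>
      (\<integral>\<^sup>+ \<omega>. U \<omega> * F (fst (\<omega> n), \<omega>) \<partial>P) = (\<integral>\<^sup>+ \<omega>. U \<omega> * F1 (fst (\<omega> 0), \<omega>) \<partial>P)"
    using markov_steps[OF le0 F] by (elim bexE)
  obtain F2 where F2: "F2 \<in> borel_measurable borel"
    and F2': "\<forall>\<mu> P. sets \<mu> = sets borel \<longrightarrow> hmm_law T Q h \<mu> P \<longrightarrow>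
      (\<integral>\<^sup>+ \<omega>. F1 (fst (\<omega> 0), \<omega>) \<partial>P) = (\<integral>\<^sup>+ x. F2 x \<partial>\<mu>)"
    using initial_step[OF F1] by (elim bexE)
  have int: "(\<integral>\<^sup>+ \<omega>. F (fst (\<omega> n), \<omega>) \<partial>P) = (\<integral>\<^sup>+ x. F2 x \<partial>m)"
    if "sets m = sets borel" "hmm_law T Q h m P" for m P
    using F1'[rule_format, OF that(2) one] F2'[rule_format, OF that] by simp
  have meas: "F2 \<in> borel_measurable m" if "sets m = sets borel" for m
    unfolding measurable_cong_sets[OF that refl] by (rule F2)
  have "AE x in \<nu>. F2 x = 0"
    using null unfolding int[OF sets(2) P\<nu>] by (simp add: nn_integral_0_iff_AE meas[OF sets(2)])
  then have "AE x in \<mu>. F2 x = 0" by (rule absolutely_continuous_AE[OF _ ac, rotated]) (simp add: sets)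
  then show ?thesis
    unfolding int[OF sets(1) P\<mu>] by (simp add: nn_integral_0_iff_AE meas[OF sets(1)])
qed

text \<open>Radon-Nikodym is applied to the pushforwards under state and observations rather than to
  the path laws, so the density is itself a function of these two arguments and can be integrated
  against a filter.\<close>

lemma law_density:
  assumes sets: "sets \<mu> = sets borel" "sets \<nu> = sets borel" and ac: "absolutely_continuous \<nu> \<mu>"
    and P\<mu>: "hmm_law T Q h \<mu> P\<mu>" and P\<nu>: "hmm_law T Q h \<nu> P\<nu>"
  shows "\<exists>g :: 'x \<times> (nat \<Rightarrow> 'x \<times> 'y) \<Rightarrow> real. g \<in> borel_measurable (borel \<Otimes>\<^sub>M obs_sigma n) \<and> (\<forall>p. 0 \<le> g p) \<and>
    (\<forall>F. F \<in> borel_measurable (borel \<Otimes>\<^sub>M obs_sigma n) \<longrightarrow>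
      (\<integral>\<^sup>+ \<omega>. ennreal (g (fst (\<omega> n), \<omega>)) * F (fst (\<omega> n), \<omega>) \<partial>P\<nu>) = (\<integral>\<^sup>+ \<omega>. F (fst (\<omega> n), \<omega>) \<partial>P\<mu>))"
proof -
  let ?S = "(borel :: 'x measure) \<Otimes>\<^sub>M (obs_sigma n :: (nat \<Rightarrow> 'x \<times> 'y) measure)"
  let ?p = "\<lambda>\<omega> :: nat \<Rightarrow> 'x \<times> 'y. (fst (\<omega> n), \<omega>)"
  let ?q\<mu> = "distr P\<mu> ?S ?p" and ?q\<nu> = "distr P\<nu> ?S ?p"
  note m\<mu> = state_obs_P_measurable[OF P\<mu>, of n] and m\<nu> = state_obs_P_measurable[OF P\<nu>, of n]
  interpret q\<mu>: prob_space ?q\<mu> by (rule prob_space.prob_space_distr[OF law_prob[OF P\<mu>] m\<mu>])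
  interpret q\<nu>: prob_space ?q\<nu> by (rule prob_space.prob_space_distr[OF law_prob[OF P\<nu>] m\<nu>])
  have int: "(\<integral>\<^sup>+ p. F p \<partial>distr P ?S ?p) = (\<integral>\<^sup>+ \<omega>. F (?p \<omega>) \<partial>P)"
    if "F \<in> borel_measurable ?S" "hmm_law T Q h m P" for F :: "_ \<Rightarrow> ennreal" and m P
    using that(1) by (intro nn_integral_distr state_obs_P_measurable[OF that(2)]) (simp only: measurable_distr_eq1)
  have qac: "absolutely_continuous ?q\<nu> ?q\<mu>"
    unfolding absolutely_continuous_def
  proof
    fix A assume "A \<in> null_sets ?q\<nu>"
    then have A: "A \<in> sets ?S" and 0: "emeasure ?q\<nu> A = 0" by (auto simp: null_sets_def)
    have iA: "(indicator A :: _ \<Rightarrow> ennreal) \<in> borel_measurable ?S" using A by (rule borel_measurable_indicator)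
    have "(\<integral>\<^sup>+ \<omega>. indicator A (?p \<omega>) \<partial>P\<nu>) = (0 :: ennreal)"
      using 0 A int[OF iA P\<nu>] by simp
    then have "(\<integral>\<^sup>+ \<omega>. indicator A (?p \<omega>) \<partial>P\<mu>) = (0 :: ennreal)"
      by (rule law_null_sets[OF sets ac P\<mu> P\<nu> iA])
    then have "emeasure ?q\<mu> A = 0" using A int[OF iA P\<mu>] by simp
    then show "A \<in> null_sets ?q\<mu>" using A by (simp add: null_sets_def)
  qed
  \<comment> \<open>The derivative is finite almost everywhere because the dominated law is
    sigma-finite, so the real-valued version represents it.\<close>
  define g where "g p = enn2real (RN_deriv ?q\<nu> ?q\<mu> p)" for p
  have RNm: "RN_deriv ?q\<nu> ?q\<mu> \<in> borel_measurable ?q\<nu>" by (rule borel_measurable_RN_deriv)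
  have gm: "g \<in> borel_measurable ?S" unfolding g_def using RNm by simp
  have gRN: "AE p in ?q\<nu>. ennreal (g p) = RN_deriv ?q\<nu> ?q\<mu> p"
    using q\<nu>.RN_deriv_finite[OF q\<mu>.sigma_finite_measure_axioms qac]
    by (auto simp: g_def less_top)
  have "(\<integral>\<^sup>+ \<omega>. ennreal (g (?p \<omega>)) * F (?p \<omega>) \<partial>P\<nu>) = (\<integral>\<^sup>+ \<omega>. F (?p \<omega>) \<partial>P\<mu>)"
    if F: "F \<in> borel_measurable ?S" for F
  proof -
    have gF: "(\<lambda>p. ennreal (g p) * F p) \<in> borel_measurable ?S"
      by (intro borel_measurable_times_ennreal F measurable_compose[OF gm measurable_ennreal])
    have "(\<integral>\<^sup>+ \<omega>. ennreal (g (?p \<omega>)) * F (?p \<omega>) \<partial>P\<nu>) = (\<integral>\<^sup>+ p. ennreal (g p) * F p \<partial>?q\<nu>)"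
      by (rule int[OF gF P\<nu>, symmetric])
    also have "\<dots> = (\<integral>\<^sup>+ p. RN_deriv ?q\<nu> ?q\<mu> p * F p \<partial>?q\<nu>)"
      using gRN by (intro nn_integral_cong_AE) auto
    also have "\<dots> = (\<integral>\<^sup>+ p. F p \<partial>density ?q\<nu> (RN_deriv ?q\<nu> ?q\<mu>))"
      using F by (intro nn_integral_density[symmetric] RNm) (simp only: measurable_distr_eq1)
    also have "density ?q\<nu> (RN_deriv ?q\<nu> ?q\<mu>) = ?q\<mu>"
      by (rule q\<nu>.density_RN_deriv[OF qac]) simp
    also have "(\<integral>\<^sup>+ p. F p \<partial>?q\<mu>) = (\<integral>\<^sup>+ \<omega>. F (?p \<omega>) \<partial>P\<mu>)" by (rule int[OF F P\<mu>])
    finally show ?thesis .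
  qed
  then show ?thesis using gm by (intro exI[of _ g]) (auto simp: g_def)
qed

end

section \<open>Likelihood ratios of the two hidden Markov laws\<close>

locale filtered_hmm = hmm T Q h
  for T :: "'x::polish_space \<Rightarrow> 'x measure" and Q :: "'z::polish_space measure"
    and h :: "'x \<Rightarrow> 'z \<Rightarrow> 'y::polish_space" +
  fixes \<mu> \<nu> :: "'x measure" and P\<mu> P\<nu> :: "(nat \<Rightarrow> 'x \<times> 'y) measure"
    and \<pi>\<mu> \<pi>\<nu> :: "nat \<Rightarrow> (nat \<Rightarrow> 'x \<times> 'y) \<Rightarrow> 'x measure"
  assumes \<mu>_sets: "sets \<mu> = sets borel" and \<nu>_sets: "sets \<nu> = sets borel"
    and abs_cont: "absolutely_continuous \<nu> \<mu>"
    and P\<mu>_law: "hmm_law T Q h \<mu> P\<mu>" and P\<nu>_law: "hmm_law T Q h \<nu> P\<nu>"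
    and \<pi>\<mu>_filter: "\<And>n. hmm_filter P\<mu> n (\<pi>\<mu> n)" and \<pi>\<nu>_filter: "\<And>n. hmm_filter P\<nu> n (\<pi>\<nu> n)"
begin

definition g :: "nat \<Rightarrow> 'x \<times> (nat \<Rightarrow> 'x \<times> 'y) \<Rightarrow> real" where
  "g n = (SOME g. g \<in> borel_measurable (borel \<Otimes>\<^sub>M obs_sigma n) \<and> (\<forall>p. 0 \<le> g p) \<and>
    (\<forall>F. F \<in> borel_measurable (borel \<Otimes>\<^sub>M obs_sigma n) \<longrightarrow>
      (\<integral>\<^sup>+ \<omega>. ennreal (g (fst (\<omega> n), \<omega>)) * F (fst (\<omega> n), \<omega>) \<partial>P\<nu>) = (\<integral>\<^sup>+ \<omega>. F (fst (\<omega> n), \<omega>) \<partial>P\<mu>)))"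

lemmas g_props = someI_ex[OF law_density[OF \<mu>_sets \<nu>_sets abs_cont P\<mu>_law P\<nu>_law], folded g_def]

lemma g_meas: "g n \<in> borel_measurable (borel \<Otimes>\<^sub>M obs_sigma n)"
  and g_nonneg: "0 \<le> g n p"
  and g_density: "F \<in> borel_measurable (borel \<Otimes>\<^sub>M obs_sigma n) \<Longrightarrow>
      (\<integral>\<^sup>+ \<omega>. ennreal (g n (fst (\<omega> n), \<omega>)) * F (fst (\<omega> n), \<omega>) \<partial>P\<nu>) = (\<integral>\<^sup>+ \<omega>. F (fst (\<omega> n), \<omega>) \<partial>P\<mu>)"
  using g_props[of n] by blast+

text \<open>The denominator of Bayes' formula. Averaging \<open>g n\<close> over the filter of
  \<open>P\<nu>\<close> gives a version of the likelihood ratio on the observations that is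
  measurable for \<open>obs_sigma n\<close> by construction. It may be infinite on a null set, hence
  the real version \<open>v\<close>.\<close>

definition w :: "nat \<Rightarrow> (nat \<Rightarrow> 'x \<times> 'y) \<Rightarrow> ennreal" where
  "w n \<omega> = (\<integral>\<^sup>+ x. ennreal (g n (x, \<omega>)) \<partial>\<pi>\<nu> n \<omega>)"

definition v :: "nat \<Rightarrow> (nat \<Rightarrow> 'x \<times> 'y) \<Rightarrow> real" where
  "v n \<omega> = enn2real (w n \<omega>)"

lemmas \<nu>_filter = law_prob[OF P\<nu>_law] law_sets[OF P\<nu>_law] \<pi>\<nu>_filter
lemmas \<mu>_filter = law_prob[OF P\<mu>_law] law_sets[OF P\<mu>_law] \<pi>\<mu>_filter

sublocale N: prob_space P\<nu> by (rule law_prob[OF P\<nu>_law])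
sublocale L: prob_space P\<mu> by (rule law_prob[OF P\<mu>_law])

lemma kernel_integral_measurable:
  assumes F: "F \<in> borel_measurable (borel \<Otimes>\<^sub>M obs_sigma n)"
  shows "(\<lambda>\<omega>. \<integral>\<^sup>+ x. F (x, \<omega>) \<partial>\<pi>\<nu> n \<omega>) \<in> borel_measurable (obs_sigma n)"
proof (rule nn_integral_measurable_subprob_algebra2)
  have "(\<lambda>p. (snd p, fst p)) \<in> (obs_sigma n :: (nat \<Rightarrow> 'x \<times> 'y) measure) \<Otimes>\<^sub>M (borel :: 'x measure) \<rightarrow>\<^sub>M borel \<Otimes>\<^sub>M obs_sigma n"
    by (rule measurable_Pair[OF measurable_snd measurable_fst])
  from measurable_compose[OF this F]
  show "(\<lambda>(\<omega>, x). F (x, \<omega>)) \<in> borel_measurable (obs_sigma n \<Otimes>\<^sub>M borel)" by (simp add: split_beta')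
  show "\<pi>\<nu> n \<in> obs_sigma n \<rightarrow>\<^sub>M subprob_algebra borel"
    by (rule measurable_prob_algebraD[OF filter_kernel[OF \<nu>_filter]])
qed

lemma section_measurable:
  assumes F: "F \<in> borel_measurable (borel \<Otimes>\<^sub>M obs_sigma n)"
  shows "(\<lambda>x. F (x, \<omega>)) \<in> borel_measurable (\<pi>\<nu> n \<omega>)"
  unfolding measurable_cong_sets[OF filter_sets[OF \<nu>_filter] refl]
  using measurable_compose[OF measurable_Pair2'[of \<omega> "obs_sigma n" borel] F] by simp

lemma obs_measurable_N: "F \<in> borel_measurable (obs_sigma n) \<Longrightarrow> F \<in> borel_measurable P\<nu>"
  by (rule measurable_compose[OF obs_P_measurable[OF \<nu>_filter]])

lemma w_meas: "w n \<in> borel_measurable (obs_sigma n)"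
  unfolding w_def
  by (rule kernel_integral_measurable[of "\<lambda>p. ennreal (g n p)"]) (rule measurable_compose[OF g_meas measurable_ennreal])

lemma v_meas: "v n \<in> borel_measurable (obs_sigma n)"
  unfolding v_def by (rule measurable_compose[OF w_meas]) measurable

lemma obs_lift: "F \<in> borel_measurable (obs_sigma n) \<Longrightarrow> (\<lambda>p. F (snd p)) \<in> borel_measurable (borel \<Otimes>\<^sub>M obs_sigma n)"
  by (rule measurable_compose[OF measurable_snd])

lemma w_integral:
  assumes F: "F \<in> borel_measurable (obs_sigma n)"
  shows "(\<integral>\<^sup>+ \<omega>. ennreal (g n (fst (\<omega> n), \<omega>)) * F \<omega> \<partial>P\<nu>) = (\<integral>\<^sup>+ \<omega>. w n \<omega> * F \<omega> \<partial>P\<nu>)"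
proof -
  have gm: "(\<lambda>p. ennreal (g n p)) \<in> borel_measurable (borel \<Otimes>\<^sub>M obs_sigma n)"
    by (rule measurable_compose[OF g_meas measurable_ennreal])
  have "(\<integral>\<^sup>+ \<omega>. ennreal (g n (fst (\<omega> n), \<omega>)) * F \<omega> \<partial>P\<nu>) = (\<integral>\<^sup>+ \<omega>. \<integral>\<^sup>+ x. ennreal (g n (x, \<omega>)) * F \<omega> \<partial>\<pi>\<nu> n \<omega> \<partial>P\<nu>)"
    using filter_integral[OF \<nu>_filter, of "\<lambda>p. ennreal (g n p) * F (snd p)"]
      borel_measurable_times_ennreal[OF gm obs_lift[OF F]] by simp
  also have "\<dots> = (\<integral>\<^sup>+ \<omega>. w n \<omega> * F \<omega> \<partial>P\<nu>)"
    unfolding w_def by (intro nn_integral_cong nn_integral_multc section_measurable[OF gm])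
  finally show ?thesis .
qed

lemma w_mass: "(\<integral>\<^sup>+ \<omega>. w n \<omega> \<partial>P\<nu>) = 1"
proof -
  have "(\<integral>\<^sup>+ \<omega>. w n \<omega> \<partial>P\<nu>) = (\<integral>\<^sup>+ \<omega>. ennreal (g n (fst (\<omega> n), \<omega>)) * 1 \<partial>P\<nu>)"
    using w_integral[of "\<lambda>_. 1" n] by simp
  also have "\<dots> = (\<integral>\<^sup>+ \<omega>. 1 \<partial>P\<mu>)" using g_density[of "\<lambda>_. 1" n] by simp
  finally show ?thesis by (simp add: L.emeasure_space_1)
qed

lemma v_w: "AE \<omega> in P\<nu>. ennreal (v n \<omega>) = w n \<omega>"
proof -
  have "AE \<omega> in P\<nu>. w n \<omega> \<noteq> \<infinity>"
    by (rule nn_integral_PInf_AE[OF obs_measurable_N[OF w_meas]]) (simp add: w_mass)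
  then show ?thesis by eventually_elim (simp add: v_def less_top)
qed

lemma v_integral:
  assumes F: "F \<in> borel_measurable (obs_sigma n)"
  shows "(\<integral>\<^sup>+ \<omega>. ennreal (g n (fst (\<omega> n), \<omega>)) * F \<omega> \<partial>P\<nu>) = (\<integral>\<^sup>+ \<omega>. ennreal (v n \<omega>) * F \<omega> \<partial>P\<nu>)"
  unfolding w_integral[OF F] using v_w[of n] by (intro nn_integral_cong_AE) auto

sublocale filter_densities P\<nu> borel "\<lambda>n \<omega>. fst (\<omega> n)" obs_sigma g v
proof
  fix n k :: nat
  show "subalgebra P\<nu> (obs_sigma n)"
    using subalgebra_path_obs[of n] law_sets[OF P\<nu>_law] sets_eq_imp_space_eq[OF law_sets[OF P\<nu>_law]]
    by (simp add: subalgebra_def)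
  show "k \<le> n \<Longrightarrow> subalgebra (obs_sigma n) (obs_sigma k :: (nat \<Rightarrow> 'x \<times> 'y) measure)" by (rule subalgebra_obs_sigma)
  show "(\<lambda>\<omega>. fst (\<omega> n)) \<in> P\<nu> \<rightarrow>\<^sub>M borel" by (rule state_P_measurable[OF \<nu>_filter])
  show "g n \<in> borel_measurable (borel \<Otimes>\<^sub>M obs_sigma n)" by (rule g_meas)
  show "0 \<le> g n p" for p by (rule g_nonneg)
  show "v n \<in> borel_measurable (obs_sigma n)" by (rule v_meas)
  show "0 \<le> v n \<omega>" for \<omega> by (simp add: v_def)
  have "(\<integral>\<^sup>+ \<omega>. ennreal (v n \<omega>) \<partial>P\<nu>) = (\<integral>\<^sup>+ \<omega>. w n \<omega> \<partial>P\<nu>)" by (rule nn_integral_cong_AE[OF v_w])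
  then show "(\<integral>\<^sup>+ \<omega>. ennreal (v n \<omega>) \<partial>P\<nu>) = 1" by (simp add: w_mass)
  show "(\<integral>\<^sup>+ \<omega>. ennreal (g n (fst (\<omega> n), \<omega>)) * F \<omega> \<partial>P\<nu>) = (\<integral>\<^sup>+ \<omega>. ennreal (v n \<omega>) * F \<omega> \<partial>P\<nu>)"
    if "F \<in> borel_measurable (obs_sigma n)" for F by (rule v_integral[OF that])
  fix F :: "'x \<times> (nat \<Rightarrow> 'x \<times> 'y) \<Rightarrow> ennreal"
  assume kn: "k \<le> n" and F: "F \<in> borel_measurable (borel \<Otimes>\<^sub>M obs_sigma n)"
  obtain F' where F': "F' \<in> borel_measurable (borel \<Otimes>\<^sub>M (obs_sigma k :: (nat \<Rightarrow> 'x \<times> 'y) measure))"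
    and int: "\<forall>\<mu> P U. hmm_law T Q h \<mu> P \<longrightarrow> adapted k U \<longrightarrow>
      (\<integral>\<^sup>+ \<omega>. U \<omega> * F (fst (\<omega> n), \<omega>) \<partial>P) = (\<integral>\<^sup>+ \<omega>. U \<omega> * F' (fst (\<omega> k), \<omega>) \<partial>P)"
    using markov_steps[OF kn F] by (elim bexE)
  have one: "adapted k (\<lambda>_. 1)" by (simp add: adapted_def)
  have gk: "adapted k (\<lambda>\<omega>. ennreal (g k (fst (\<omega> k), \<omega>)))"
    by (rule adapted_state_obs[of "\<lambda>p. ennreal (g k p)"]) (rule measurable_compose[OF g_meas measurable_ennreal])
  \<comment> \<open>Both sides equal the \<open>P\<mu>\<close>-expectation of \<open>F\<close>. On
    the left, \<open>F\<close> is pulled back to time \<open>k\<close> under \<open>P\<nu>\<close>,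
    the measure is changed there, and the same \<open>F'\<close> is pushed forward to time
    \<open>n\<close> under \<open>P\<mu>\<close>.\<close>
  have "(\<integral>\<^sup>+ \<omega>. ennreal (g k (fst (\<omega> k), \<omega>)) * F (fst (\<omega> n), \<omega>) \<partial>P\<nu>)
      = (\<integral>\<^sup>+ \<omega>. ennreal (g k (fst (\<omega> k), \<omega>)) * F' (fst (\<omega> k), \<omega>) \<partial>P\<nu>)"
    by (rule int[rule_format, OF P\<nu>_law gk])
  also have "\<dots> = (\<integral>\<^sup>+ \<omega>. F' (fst (\<omega> k), \<omega>) \<partial>P\<mu>)" by (rule g_density[OF F'])
  also have "\<dots> = (\<integral>\<^sup>+ \<omega>. F (fst (\<omega> n), \<omega>) \<partial>P\<mu>)"
    using int[rule_format, OF P\<mu>_law one] by simp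
  also have "\<dots> = (\<integral>\<^sup>+ \<omega>. ennreal (g n (fst (\<omega> n), \<omega>)) * F (fst (\<omega> n), \<omega>) \<partial>P\<nu>)"
    by (rule g_density[OF F, symmetric])
  finally show "(\<integral>\<^sup>+ \<omega>. ennreal (g k (fst (\<omega> k), \<omega>)) * F (fst (\<omega> n), \<omega>) \<partial>P\<nu>)
      = (\<integral>\<^sup>+ \<omega>. ennreal (g n (fst (\<omega> n), \<omega>)) * F (fst (\<omega> n), \<omega>) \<partial>P\<nu>)" .
qed

section \<open>Bayes' formula for the filters\<close>

definition r :: "nat \<Rightarrow> 'x \<times> (nat \<Rightarrow> 'x \<times> 'y) \<Rightarrow> real" where
  "r n p = g n p / v n (snd p)"

lemma r_meas: "r n \<in> borel_measurable (borel \<Otimes>\<^sub>M obs_sigma n)"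
  unfolding r_def by (intro borel_measurable_divide g_meas measurable_compose[OF measurable_snd v_meas])

lemma r_nonneg: "0 \<le> r n p"
  by (simp add: r_def g_nonneg v_nonneg)

lemma L_obs_integral:
  assumes F: "F \<in> borel_measurable (obs_sigma n)"
  shows "(\<integral>\<^sup>+ \<omega>. F \<omega> \<partial>P\<mu>) = (\<integral>\<^sup>+ \<omega>. ennreal (v n \<omega>) * F \<omega> \<partial>P\<nu>)"
  using g_density[OF obs_lift[OF F]] v_integral[OF F] by simp

text \<open>Under \<open>P\<mu>\<close> the kernel \<open>\<pi>\<nu>\<close> is in general not the
  conditional law of the state. The inner integral is observable, so the weight \<open>v n\<close>
  moves the outer one to \<open>P\<nu>\<close>, where \<open>filter_integral\<close>
  applies.\<close>

lemma L_kernel_integral: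
  assumes F: "F \<in> borel_measurable (borel \<Otimes>\<^sub>M obs_sigma n)"
  shows "(\<integral>\<^sup>+ \<omega>. \<integral>\<^sup>+ x. F (x, \<omega>) \<partial>\<pi>\<nu> n \<omega> \<partial>P\<mu>) = (\<integral>\<^sup>+ \<omega>. ennreal (v n \<omega>) * F (fst (\<omega> n), \<omega>) \<partial>P\<nu>)"
proof -
  have vm: "(\<lambda>p. ennreal (v n (snd p))) \<in> borel_measurable (borel \<Otimes>\<^sub>M obs_sigma n)"
    by (rule obs_lift[of "\<lambda>\<omega>. ennreal (v n \<omega>)"]) (rule measurable_compose[OF v_meas measurable_ennreal])
  have "(\<integral>\<^sup>+ \<omega>. \<integral>\<^sup>+ x. F (x, \<omega>) \<partial>\<pi>\<nu> n \<omega> \<partial>P\<mu>)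
      = (\<integral>\<^sup>+ \<omega>. ennreal (v n \<omega>) * (\<integral>\<^sup>+ x. F (x, \<omega>) \<partial>\<pi>\<nu> n \<omega>) \<partial>P\<nu>)"
    by (rule L_obs_integral[OF kernel_integral_measurable[OF F]])
  also have "\<dots> = (\<integral>\<^sup>+ \<omega>. (\<integral>\<^sup>+ x. ennreal (v n \<omega>) * F (x, \<omega>) \<partial>\<pi>\<nu> n \<omega>) \<partial>P\<nu>)"
    by (intro nn_integral_cong nn_integral_cmult[symmetric] section_measurable[OF F])
  also have "\<dots> = (\<integral>\<^sup>+ \<omega>. ennreal (v n \<omega>) * F (fst (\<omega> n), \<omega>) \<partial>P\<nu>)"
    using filter_integral[OF \<nu>_filter borel_measurable_times_ennreal[OF vm F]] by simp
  finally show ?thesis .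
qed

text \<open>For a fixed Borel set both sides are observable, and their
  \<open>P\<mu>\<close>-integrals over every observable event agree, so they are almost surely
  equal. The countable determining class \<open>C\<close> turns this into an equality of measures
  off one null set.\<close>

lemma filter_density:
  "AE \<omega> in P\<mu>. \<pi>\<mu> n \<omega> = density (\<pi>\<nu> n \<omega>) (\<lambda>x. ennreal (r n (x, \<omega>)))"
proof -
  obtain C :: "'x set set" where C: "countable C" "C \<subseteq> sets borel"
    and eqI: "\<forall>M N. sets M = sets borel \<longrightarrow> sets N = sets borel \<longrightarrow> finite_measure M \<longrightarrow>
      (\<forall>A\<in>C. emeasure M A = emeasure N A) \<longrightarrow> M = N"
    by (rule measure_eqI_borel_countable)
  have sub: "subalgebra P\<mu> (obs_sigma n)"
    using subalgebra_path_obs[of n] law_sets[OF P\<mu>_law] sets_eq_imp_space_eq[OF law_sets[OF P\<mu>_law]]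
    by (simp add: subalgebra_def)
  \<comment> \<open>The uniqueness argument tests all sets of its measure space, while equality of
    the integrals is established for observable events; hence the passage to the
    restriction.\<close>
  interpret LS: prob_space "restr_to_subalg P\<mu> (obs_sigma n)"
    by (rule prob_space_restr_to_subalg[OF sub L.prob_space_axioms])
  have rm: "(\<lambda>p. ennreal (r n p)) \<in> borel_measurable (borel \<Otimes>\<^sub>M obs_sigma n)"
    by (rule measurable_compose[OF r_meas measurable_ennreal])
  have sets_dens: "sets (density (\<pi>\<nu> n \<omega>) (\<lambda>x. ennreal (r n (x, \<omega>)))) = sets borel" for \<omega>
    by (simp add: filter_sets[OF \<nu>_filter])
  have "AE \<omega> in P\<mu>. emeasure (\<pi>\<mu> n \<omega>) A = emeasure (density (\<pi>\<nu> n \<omega>) (\<lambda>x. ennreal (r n (x, \<omega>)))) A"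
    if A: "A \<in> sets borel" for A
  proof -
    let ?F = "\<lambda>p. ennreal (r n p) * indicator A (fst p)"
    have iA: "(\<lambda>p. indicator A (fst p) :: ennreal) \<in> borel_measurable (borel \<Otimes>\<^sub>M (obs_sigma n :: (nat \<Rightarrow> 'x \<times> 'y) measure))"
      by (rule measurable_compose[OF measurable_fst borel_measurable_indicator[OF A]])
    have Fm: "?F \<in> borel_measurable (borel \<Otimes>\<^sub>M obs_sigma n)" by (rule borel_measurable_times_ennreal[OF rm iA])
    have dens: "emeasure (density (\<pi>\<nu> n \<omega>) (\<lambda>x. ennreal (r n (x, \<omega>)))) A = (\<integral>\<^sup>+ x. ?F (x, \<omega>) \<partial>\<pi>\<nu> n \<omega>)" for \<omega>
      using A section_measurable[OF rm] by (simp add: emeasure_density filter_sets[OF \<nu>_filter])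
    have m1: "(\<lambda>\<omega>. emeasure (\<pi>\<mu> n \<omega>) A) \<in> borel_measurable (obs_sigma n)"
      using measurable_compose[OF measurable_prob_algebraD[OF filter_kernel[OF \<mu>_filter]] measurable_emeasure_subprob_algebra[OF A]] .
    have m2: "(\<lambda>\<omega>. emeasure (density (\<pi>\<nu> n \<omega>) (\<lambda>x. ennreal (r n (x, \<omega>)))) A) \<in> borel_measurable (obs_sigma n)"
      unfolding dens by (rule kernel_integral_measurable[OF Fm])
    have "AE \<omega> in restr_to_subalg P\<mu> (obs_sigma n).
        emeasure (\<pi>\<mu> n \<omega>) A = emeasure (density (\<pi>\<nu> n \<omega>) (\<lambda>x. ennreal (r n (x, \<omega>)))) A"
    proof (rule LS.density_unique2)
      show "(\<lambda>\<omega>. emeasure (\<pi>\<mu> n \<omega>) A) \<in> borel_measurable (restr_to_subalg P\<mu> (obs_sigma n))"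
        "(\<lambda>\<omega>. emeasure (density (\<pi>\<nu> n \<omega>) (\<lambda>x. ennreal (r n (x, \<omega>)))) A) \<in> borel_measurable (restr_to_subalg P\<mu> (obs_sigma n))"
        using m1 m2 by (auto intro: measurable_in_subalg[OF sub])
      fix B assume "B \<in> sets (restr_to_subalg P\<mu> (obs_sigma n))"
      then have B: "B \<in> sets (obs_sigma n)" by (simp add: sets_restr_to_subalg[OF sub])
      have iB: "(indicator B :: _ \<Rightarrow> ennreal) \<in> borel_measurable (obs_sigma n)" by (rule borel_measurable_indicator[OF B])
      have FB: "(\<lambda>p. ?F p * indicator B (snd p)) \<in> borel_measurable (borel \<Otimes>\<^sub>M obs_sigma n)"
        by (rule borel_measurable_times_ennreal[OF Fm obs_lift[OF iB]])
      have AB: "(\<lambda>p. indicator A (fst p) * indicator B (snd p) :: ennreal) \<in> borel_measurable (borel \<Otimes>\<^sub>M obs_sigma n)"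
        by (rule borel_measurable_times_ennreal[OF iA obs_lift[OF iB]])
      have "(\<integral>\<^sup>+ \<omega>\<in>B. emeasure (\<pi>\<mu> n \<omega>) A \<partial>restr_to_subalg P\<mu> (obs_sigma n)) = (\<integral>\<^sup>+ \<omega>\<in>B. emeasure (\<pi>\<mu> n \<omega>) A \<partial>P\<mu>)"
        by (rule nn_integral_subalgebra2[OF sub borel_measurable_times_ennreal[OF m1 iB]])
      also have "\<dots> = emeasure P\<mu> {\<omega>. fst (\<omega> n) \<in> A \<and> \<omega> \<in> B}"
        by (rule filter_rectangle[OF \<mu>_filter A B, symmetric])
      also have "\<dots> = (\<integral>\<^sup>+ \<omega>. indicator {\<omega>. fst (\<omega> n) \<in> A \<and> \<omega> \<in> B} \<omega> \<partial>P\<mu>)"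
      proof (rule nn_integral_indicator[symmetric])
        have "A \<times> B \<in> sets (borel \<Otimes>\<^sub>M obs_sigma n)" using A B by simp
        from measurable_sets[OF state_obs_P_measurable[OF P\<mu>_law] this]
        show "{\<omega>. fst (\<omega> n) \<in> A \<and> \<omega> \<in> B} \<in> sets P\<mu>"
          by (simp add: filter_space[OF \<mu>_filter] vimage_def)
      qed
      also have "\<dots> = (\<integral>\<^sup>+ \<omega>. indicator A (fst (\<omega> n)) * indicator B \<omega> \<partial>P\<mu>)"
        by (intro nn_integral_cong) (auto simp: indicator_def)
      also have "\<dots> = (\<integral>\<^sup>+ \<omega>. ennreal (z n \<omega>) * (indicator A (fst (\<omega> n)) * indicator B \<omega>) \<partial>P\<nu>)"
        using g_density[OF AB] by (simp add: z_def)
      also have "\<dots> = (\<integral>\<^sup>+ \<omega>. ennreal (v n \<omega>) * (?F (fst (\<omega> n), \<omega>) * indicator B \<omega>) \<partial>P\<nu>)"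
      proof (rule nn_integral_cong_AE)
        show "AE \<omega> in P\<nu>. ennreal (z n \<omega>) * (indicator A (fst (\<omega> n)) * indicator B \<omega>)
            = ennreal (v n \<omega>) * (?F (fst (\<omega> n), \<omega>) * indicator B \<omega>)"
          using AE_z_zero[OF order_refl, of n]
        proof eventually_elim
          case (elim \<omega>)
          \<comment> \<open>Where \<open>v n\<close> vanishes, \<open>r n\<close> is zero by the
            division convention, and \<open>AE_z_zero\<close> guarantees that \<open>z n\<close> is
            zero as well.\<close>
          then have "z n \<omega> = v n \<omega> * r n (fst (\<omega> n), \<omega>)" by (auto simp: z_def r_def)
          then show ?case by (simp add: ennreal_mult v_nonneg r_nonneg mult.assoc)
        qed
      qed
      also have "\<dots> = (\<integral>\<^sup>+ \<omega>. \<integral>\<^sup>+ x. ?F (x, \<omega>) * indicator B \<omega> \<partial>\<pi>\<nu> n \<omega> \<partial>P\<mu>)"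
        using L_kernel_integral[OF FB] by simp
      also have "\<dots> = (\<integral>\<^sup>+ \<omega>\<in>B. emeasure (density (\<pi>\<nu> n \<omega>) (\<lambda>x. ennreal (r n (x, \<omega>)))) A \<partial>P\<mu>)"
        unfolding dens by (intro nn_integral_cong nn_integral_multc section_measurable[OF Fm])
      also have "\<dots> = (\<integral>\<^sup>+ \<omega>\<in>B. emeasure (density (\<pi>\<nu> n \<omega>) (\<lambda>x. ennreal (r n (x, \<omega>)))) A \<partial>restr_to_subalg P\<mu> (obs_sigma n))"
        by (rule nn_integral_subalgebra2[OF sub borel_measurable_times_ennreal[OF m2 iB], symmetric])
      finally show "(\<integral>\<^sup>+ \<omega>\<in>B. emeasure (\<pi>\<mu> n \<omega>) A \<partial>restr_to_subalg P\<mu> (obs_sigma n))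
        = (\<integral>\<^sup>+ \<omega>\<in>B. emeasure (density (\<pi>\<nu> n \<omega>) (\<lambda>x. ennreal (r n (x, \<omega>)))) A \<partial>restr_to_subalg P\<mu> (obs_sigma n))" .
    qed
    then show ?thesis by (rule AE_restr_to_subalg[OF sub])
  qed
  then have "AE \<omega> in P\<mu>. \<forall>A\<in>C. emeasure (\<pi>\<mu> n \<omega>) A = emeasure (density (\<pi>\<nu> n \<omega>) (\<lambda>x. ennreal (r n (x, \<omega>)))) A"
    using C by (subst AE_ball_countable) auto
  then show ?thesis
  proof eventually_elim
    case (elim \<omega>)
    show ?case
    proof (rule eqI[rule_format])
      show "finite_measure (\<pi>\<mu> n \<omega>)" using filter_prob[OF \<mu>_filter] by (rule prob_space.finite_measure)
    qed (use elim in \<open>auto simp: filter_sets[OF \<mu>_filter] filter_sets[OF \<nu>_filter]\<close>)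
  qed
qed

text \<open>The computation common to entropy and total variation, for a functional of the form of
  an f-divergence: \<open>F\<close> is the perspective of \<open>f\<close>. The weight
  \<open>v n\<close> produced by the change of measure combines with \<open>f (z / v)\<close> into
  \<open>F z v\<close>, and \<open>F 0 0 = 0\<close> covers the paths with \<open>v n = 0\<close>,
  where \<open>z n\<close> vanishes almost surely.\<close>

lemma filter_functional:
  fixes \<Phi> :: "'x measure \<Rightarrow> 'x measure \<Rightarrow> ennreal" and f :: "real \<Rightarrow> real" and F :: "real \<Rightarrow> real \<Rightarrow> real"
  assumes \<Phi>: "\<And>R P r. \<lbrakk>prob_space R; prob_space P; r \<in> borel_measurable R; \<And>x. 0 \<le> r x;
        P = density R (\<lambda>x. ennreal (r x))\<rbrakk> \<Longrightarrow> \<Phi> P R = (\<integral>\<^sup>+ x. ennreal (f (r x)) \<partial>R)"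
    and f: "f \<in> borel_measurable borel"
    and F: "\<And>z v. 0 < v \<Longrightarrow> v * f (z / v) = F z v" "F 0 0 = 0"
  shows "(\<integral>\<^sup>+ \<omega>. \<Phi> (\<pi>\<mu> n \<omega>) (\<pi>\<nu> n \<omega>) \<partial>P\<mu>) = (\<integral>\<^sup>+ \<omega>. ennreal (F (z n \<omega>) (v n \<omega>)) \<partial>P\<nu>)"
proof -
  have fm: "(\<lambda>p. ennreal (f (r n p))) \<in> borel_measurable (borel \<Otimes>\<^sub>M obs_sigma n)"
    by (rule measurable_compose[OF measurable_compose[OF r_meas f] measurable_ennreal])
  have "(\<integral>\<^sup>+ \<omega>. \<Phi> (\<pi>\<mu> n \<omega>) (\<pi>\<nu> n \<omega>) \<partial>P\<mu>) = (\<integral>\<^sup>+ \<omega>. \<integral>\<^sup>+ x. ennreal (f (r n (x, \<omega>))) \<partial>\<pi>\<nu> n \<omega> \<partial>P\<mu>)"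
  proof (rule nn_integral_cong_AE)
    show "AE \<omega> in P\<mu>. \<Phi> (\<pi>\<mu> n \<omega>) (\<pi>\<nu> n \<omega>) = (\<integral>\<^sup>+ x. ennreal (f (r n (x, \<omega>))) \<partial>\<pi>\<nu> n \<omega>)"
      using filter_density[of n]
    proof eventually_elim
      case (elim \<omega>)
      show ?case
      proof (rule \<Phi>[OF filter_prob[OF \<nu>_filter] filter_prob[OF \<mu>_filter] _ _ elim])
        show "(\<lambda>x. r n (x, \<omega>)) \<in> borel_measurable (\<pi>\<nu> n \<omega>)"
          unfolding measurable_cong_sets[OF filter_sets[OF \<nu>_filter] refl]
          using measurable_compose[OF measurable_Pair2'[of \<omega> "obs_sigma n" borel] r_meas] by simp
      qed (rule r_nonneg)
    qed
  qed
  also have "\<dots> = (\<integral>\<^sup>+ \<omega>. ennreal (v n \<omega>) * ennreal (f (r n (fst (\<omega> n), \<omega>))) \<partial>P\<nu>)"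
    by (rule L_kernel_integral[OF fm])
  also have "\<dots> = (\<integral>\<^sup>+ \<omega>. ennreal (F (z n \<omega>) (v n \<omega>)) \<partial>P\<nu>)"
  proof (rule nn_integral_cong_AE)
    show "AE \<omega> in P\<nu>. ennreal (v n \<omega>) * ennreal (f (r n (fst (\<omega> n), \<omega>))) = ennreal (F (z n \<omega>) (v n \<omega>))"
      using AE_z_zero[OF order_refl, of n]
    proof eventually_elim
      case (elim \<omega>)
      show ?case
      proof (cases "v n \<omega> = 0")
        case False
        then have "0 < v n \<omega>" using v_nonneg[of n \<omega>] by (simp add: less_le)
        from F(1)[OF this, of "z n \<omega>"] show ?thesis
          by (simp add: r_def z_def v_nonneg flip: ennreal_mult')
      qed (use elim F(2) in auto)
    qed
  qed
  finally show ?thesis .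
qed

lemma entropy_filter: "(\<integral>\<^sup>+ \<omega>. e2ennreal (rel_entropy (\<pi>\<mu> n \<omega>) (\<pi>\<nu> n \<omega>)) \<partial>P\<mu>) = entropy_gap n"
proof (rule filter_functional)
  show "(\<lambda>r. ent_gap r 1) \<in> borel_measurable borel" unfolding ent_gap_def by measurable
  show "v * ent_gap (z / v) 1 = ent_gap z v" if "0 < v" for z v
    using that by (simp add: ent_gap_def field_simps)
  show "ent_gap 0 0 = 0" by (simp add: ent_gap_def)
qed (rule rel_entropy_density)

lemma tv_filter: "(\<integral>\<^sup>+ \<omega>. ennreal (tv_dist (\<pi>\<mu> n \<omega>) (\<pi>\<nu> n \<omega>)) \<partial>P\<mu>) = L1_gap n"
proof (rule filter_functional)
  show "v * \<bar>z / v - 1\<bar> = \<bar>z - v\<bar>" if "0 < v" for z v :: real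
  proof -
    have "v * \<bar>z / v - 1\<bar> = \<bar>v * (z / v - 1)\<bar>" using that by (simp add: abs_mult)
    also have "v * (z / v - 1) = z - v" using that by (simp add: field_simps)
    finally show ?thesis .
  qed
qed (auto intro: tv_dist_density)

end

section \<open>The equivalence for the filters\<close>

theorem theorem7:
  fixes T :: "'x::polish_space \<Rightarrow> 'x measure"
    and Q :: "'z::polish_space measure"
    and h :: "'x \<Rightarrow> 'z \<Rightarrow> 'y::polish_space"
    and \<mu> \<nu> :: "'x measure"
    and P\<mu> P\<nu> :: "(nat \<Rightarrow> 'x \<times> 'y) measure"
    and \<pi>\<mu> \<pi>\<nu> :: "nat \<Rightarrow> (nat \<Rightarrow> 'x \<times> 'y) \<Rightarrow> 'x measure"
    and n\<^sub>0 m :: nat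
  assumes T_kernel: "T \<in> borel \<rightarrow>\<^sub>M prob_algebra borel"
    and Q_prob: "prob_space Q" and Q_sets: "sets Q = sets borel"
    and h_meas: "case_prod h \<in> borel_measurable (borel \<Otimes>\<^sub>M borel)"
    and \<mu>_prob: "prob_space \<mu>" and \<mu>_sets: "sets \<mu> = sets borel"
    and \<nu>_prob: "prob_space \<nu>" and \<nu>_sets: "sets \<nu> = sets borel"
    and abs_cont: "absolutely_continuous \<nu> \<mu>"
    and P\<mu>_law: "hmm_law T Q h \<mu> P\<mu>"
    and P\<nu>_law: "hmm_law T Q h \<nu> P\<nu>"
    and \<pi>\<mu>_filter: "\<And>n. hmm_filter P\<mu> n (\<pi>\<mu> n)"
    and \<pi>\<nu>_filter: "\<And>n. hmm_filter P\<nu> n (\<pi>\<nu> n)"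
    and fin_n0: "(\<integral>\<^sup>+ \<omega>. e2ennreal (rel_entropy (\<pi>\<mu> n\<^sub>0 \<omega>) (\<pi>\<nu> n\<^sub>0 \<omega>)) \<partial>P\<mu>) < \<infinity>"
    and fin_m: "rel_entropy (restr_to_subalg P\<mu> (obs_sigma m)) (restr_to_subalg P\<nu> (obs_sigma m)) < \<infinity>"
  shows "(\<lambda>n. \<integral>\<^sup>+ \<omega>. e2ennreal (rel_entropy (\<pi>\<mu> n \<omega>) (\<pi>\<nu> n \<omega>)) \<partial>P\<mu>) \<longlonglongrightarrow> 0
     \<longleftrightarrow> (\<lambda>n. \<integral>\<^sup>+ \<omega>. ennreal (tv_dist (\<pi>\<mu> n \<omega>) (\<pi>\<nu> n \<omega>)) \<partial>P\<mu>) \<longlonglongrightarrow> 0"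
proof -
  interpret filtered_hmm T Q h \<mu> \<nu> P\<mu> P\<nu> \<pi>\<mu> \<pi>\<nu>
    by (intro filtered_hmm.intro hmm.intro filtered_hmm_axioms.intro) fact+
  \<comment> \<open>The time \<open>n\<^sub>0\<close> plays the part of the reference time
    \<open>k\<close> in the abstract equivalence.\<close>
  show ?thesis
    unfolding entropy_filter tv_filter
    by (rule entropy_gap_tendsto_iff[of n\<^sub>0]) (use fin_n0 in \<open>simp only: entropy_filter\<close>)
qed

end
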